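(* Let $m\ge2$, let $f_i:\mathbb{R}^{n_i}\to\mathbb{R}$ ($i=1,\dots,m$) be closed proper convex, $A_i\in\mathbb{R}^{l\times n_i}$, $b\in\mathbb{R}^l$, and suppose that $f_m$ is $L$-gradient Lipschitz continuous ($L>0$). Let $(x^*,\lambda^* )$, $x^*=(x_1^*,\dots,x_m^* )$, be a saddle point of the Lagrangian $L(x,\lambda)=\sum_{i=1}^m f_i(x_i)-\lambda^T(\sum_{i=1}^mA_ix_i-b)$, and $v^*=(A_2x_2^*,\dots,A_mx_m^*,\lambda^* )$. Let $\gamma\in(0,1]$ and let $\beta^k>0$ satisfy, for all $k$, $$\frac1{(\beta^k)^2}+\frac{\sigma_{\min}(A_mA_m^T)}{L\beta^k}\ \ge\ \frac1{(\beta^{k+1})^2}+(1-\gamma)\frac{\sigma_{\min}(A_mA_m^T)}{L\beta^{k+1}}.$$ Let $\{v^k\}$, $v^k=(A_2x_2^k,\dots,A_mx_m^k,\lambda^k)$, together with $\widetilde x^k,\widetilde\lambda^k$ and $\widetilde v^k=(A_2\widetilde x_2^k,\dots,A_m\widetilde x_m^k,\widetilde\lambda^k)$, be generated by the prediction step $$\begin{cases}\widetilde x_1^k\in\arg\min_{x_1}L_{\beta^k}(x_1,x_2^k,\dots,x_m^k,\lambda^k),\\ \widetilde x_j^k\in\arg\min_{x_j}L_{\beta^k}(\widetilde x_1^k,\dots,\widetilde x_{j-1}^k,x_j,x_{j+1}^k,\dots,x_m^k,\lambda^k),\quad j=2,\dots,m,\\ \widetilde\lambda^k=\lambda^k-\beta^k\big(A_1\widetilde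 x_1^k+\sum_{j=2}^mA_jx_j^k-b\big),\end{cases}$$ and the correction step $v^{k+1}=v^k-M^k(v^k-\widetilde v^k)$, where $M^k=(P^k)^{-T}N^k$, $$P^k=\begin{pmatrix}\sqrt{\beta^k}J&0\\0&\frac1{\sqrt{\beta^k}}I_l\end{pmatrix},\qquad N^k=\gamma\begin{pmatrix}\sqrt{\beta^k}I_{(m-1)l}&0\\-\sqrt{\beta^k}\,\widetilde I&\frac1{\sqrt{\beta^k}}I_l\end{pmatrix}.$$ Put $$Q^k=\begin{pmatrix}\beta^kJ&0\\-\widetilde I&\frac1{\beta^k}I_l\end{pmatrix},\quad H^k=\frac1\gamma\begin{pmatrix}\beta^kJJ^T&0\\0&\frac1{\beta^k}I_l\end{pmatrix},\quad G^k=(Q^k)^T+Q^k-(M^k)^TH^kM^k,$$ $$H_0^k=\frac1\gamma\begin{pmatrix}JJ^T&0\\0&\Big(\frac1{(\beta^k)^2}+(1-\gamma)\frac{\sigma_{\min}(A_mA_m^T)}{L\beta^k}\Big)I_l\end{pmatrix}.$$ Then the convergence condition (CC3) holds with $r^k=\frac1{\beta^k}$, $R=I_{n_m}$, $z^k=\nabla f_m(\widetilde x_m^k)$, $\sigma=\frac1L$, $\Theta^k\equiv0$, this $H_0^k$, and the special setting $z'=\nabla f_m(x_m^* )$, $v'=v^*$: that is, $r^k>0$, $H_0^k\succeq0$, and for every $k$ $$\frac1{\beta^k}\left(\|v^{k+1}-v^*\|^2_{H^k}+\frac1L\|\nabla f_m(\widetilde x_m^k)-\nabla f_m(x_m^*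 )\|^2-\|v^k-v^*\|^2_{H^k}+\|v^k-\widetilde v^k\|^2_{G^k}\right)\ \ge\ \|v^{k+1}-v^*\|^2_{H_0^{k+1}}-\|v^k-v^*\|^2_{H_0^k}.$$
   Context: $\|y\|_D^2:=y^TDy$ for a symmetric matrix $D$; $\sigma_{\min}(\cdot)$ is the minimal eigenvalue. $J\in\mathbb{R}^{(m-1)l\times(m-1)l}$ is the block lower triangular matrix with $(m-1)\times(m-1)$ blocks, all blocks on and below the diagonal being $I_l$ and all blocks above the diagonal being $0$; $\widetilde I=(I_l\ \cdots\ I_l)\in\mathbb{R}^{l\times(m-1)l}$. The augmented Lagrangian is $L_\beta(x_1,\dots,x_m,\lambda)=\sum_if_i(x_i)-\lambda^T(\sum_iA_ix_i-b)+\frac\beta2\|\sum_iA_ix_i-b\|^2$. In the prediction step the minimizers depend on $x_2^k,\dots,x_m^k$ only through the products $A_jx_j^k$, so the iteration is on the vector $v^k$, whose blocks are denoted $A_2x_2^k,\dots,A_mx_m^k,\lambda^k$. $f_m$ is $L$-gradient Lipschitz continuous if it is differentiable and $f_m(y)\le f_m(x)+\langle\nabla f_m(x),y-x\rangle+\frac L2\|y-x\|^2$ for all $x,y$. $(x^*,\lambda^* )$ is a saddle point if $L(x^*,\lambda)\le L(x^*,\lambda^* )\le L(x,\lambda^* )$ for all $x,\lambda$. The general form of condition (CC3) is: for $r^k>0$, $H_0^k\succeq0$, $\Theta^k\ge0$, $$r^k\left(\|v^{k+1}-v'\|^2_{H^k}+\sigma\|z^k-z'\|^2_R-\|v^k-v'\|^2_{H^k}+\|v^k-\widetilde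 v^k\|^2_{G^k}\right)\ge\|v^{k+1}-v'\|^2_{H_0^{k+1}}-\|v^k-v'\|^2_{H_0^k}+\Theta^{k+1}-\Theta^k.$$ The minimization subproblems are assumed solvable, so that the sequence is well defined. *)

theory Defs
  imports
    "Jordan_Normal_Form.Spectral_Radius"
    "Jordan_Normal_Form.Gauss_Jordan_Elimination"
begin

text \<open>
  The space of real \<open>n\<close>-vectors is \<open>carrier_vec n\<close>. Since \<open>vec\<close> carries no topology or vector
  space class, the notions of convex analysis are stated relative to this carrier.
\<close>

definition vnorm :: "real vec \<Rightarrow> real" where
  "vnorm x = sqrt (x \<bullet> x)"

definition qform :: "real mat \<Rightarrow> real vec \<Rightarrow> real" where
  "qform D y = y \<bullet> (D *\<^sub>v y)"

definition pos_semidef :: "nat \<Rightarrow> real mat \<Rightarrow> bool" where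
  "pos_semidef n D \<longleftrightarrow> D \<in> carrier_mat n n \<and> transpose_mat D = D \<and>
     (\<forall>y\<in>carrier_vec n. 0 \<le> qform D y)"

definition sigma_min :: "real mat \<Rightarrow> real" where
  "sigma_min D = Min (spectrum D)"

text \<open>
  A function with finite values everywhere is proper, and it is closed iff it is lower
  semicontinuous.
\<close>

definition lower_semicont :: "nat \<Rightarrow> (real vec \<Rightarrow> real) \<Rightarrow> bool" where
  "lower_semicont n f \<longleftrightarrow>
     (\<forall>x\<in>carrier_vec n. \<forall>e>0. \<exists>d>0. \<forall>y\<in>carrier_vec n. vnorm (y - x) < d \<longrightarrow> f x - e < f y)"

definition convex_fun :: "nat \<Rightarrow> (real vec \<Rightarrow> real) \<Rightarrow> bool" where
  "convex_fun n f \<longleftrightarrow>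
     (\<forall>x\<in>carrier_vec n. \<forall>y\<in>carrier_vec n. \<forall>t. 0 \<le> t \<and> t \<le> 1 \<longrightarrow>
        f ((1 - t) \<cdot>\<^sub>v x + t \<cdot>\<^sub>v y) \<le> (1 - t) * f x + t * f y)"

definition closed_proper_convex :: "nat \<Rightarrow> (real vec \<Rightarrow> real) \<Rightarrow> bool" where
  "closed_proper_convex n f \<longleftrightarrow> convex_fun n f \<and> lower_semicont n f"

definition has_gradient :: "nat \<Rightarrow> (real vec \<Rightarrow> real) \<Rightarrow> real vec \<Rightarrow> real vec \<Rightarrow> bool" where
  "has_gradient n f x g \<longleftrightarrow> g \<in> carrier_vec n \<and>
     (\<forall>e>0. \<exists>d>0. \<forall>y\<in>carrier_vec n. vnorm (y - x) < d \<longrightarrow>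
        \<bar>f y - f x - g \<bullet> (y - x)\<bar> \<le> e * vnorm (y - x))"

definition gradient :: "nat \<Rightarrow> (real vec \<Rightarrow> real) \<Rightarrow> real vec \<Rightarrow> real vec" where
  "gradient n f x = (THE g. has_gradient n f x g)"

definition gradient_lipschitz :: "nat \<Rightarrow> real \<Rightarrow> (real vec \<Rightarrow> real) \<Rightarrow> bool" where
  "gradient_lipschitz n L f \<longleftrightarrow>
     (\<forall>x\<in>carrier_vec n. \<exists>g. has_gradient n f x g) \<and>
     (\<forall>x\<in>carrier_vec n. \<forall>y\<in>carrier_vec n.
        f y \<le> f x + gradient n f x \<bullet> (y - x) + L / 2 * (vnorm (y - x))\<^sup>2)"

text \<open>
  Families \<open>x\<^sub>1, \<dots>, x\<^sub>m\<close> are functions on \<open>nat\<close> of which only the values on \<open>{1..m}\<close> matter.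
\<close>

definition lagrangian ::
  "nat \<Rightarrow> nat \<Rightarrow> (nat \<Rightarrow> real vec \<Rightarrow> real) \<Rightarrow> (nat \<Rightarrow> real mat) \<Rightarrow> real vec \<Rightarrow>
   (nat \<Rightarrow> real vec) \<Rightarrow> real vec \<Rightarrow> real" where
  "lagrangian m l f A b x lam =
     (\<Sum>i=1..m. f i (x i)) -
     lam \<bullet> (finsum_vec TYPE(real) l (\<lambda>i. A i *\<^sub>v x i) {1..m} - b)"

definition aug_lagrangian ::
  "nat \<Rightarrow> nat \<Rightarrow> (nat \<Rightarrow> real vec \<Rightarrow> real) \<Rightarrow> (nat \<Rightarrow> real mat) \<Rightarrow> real vec \<Rightarrow> real \<Rightarrow>
   (nat \<Rightarrow> real vec) \<Rightarrow> real vec \<Rightarrow> real" where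
  "aug_lagrangian m l f A b \<beta> x lam =
     lagrangian m l f A b x lam +
     \<beta> / 2 * (vnorm (finsum_vec TYPE(real) l (\<lambda>i. A i *\<^sub>v x i) {1..m} - b))\<^sup>2"

definition is_saddle_point ::
  "nat \<Rightarrow> nat \<Rightarrow> (nat \<Rightarrow> nat) \<Rightarrow> (nat \<Rightarrow> real vec \<Rightarrow> real) \<Rightarrow> (nat \<Rightarrow> real mat) \<Rightarrow> real vec \<Rightarrow>
   (nat \<Rightarrow> real vec) \<Rightarrow> real vec \<Rightarrow> bool" where
  "is_saddle_point m l n f A b xs lams \<longleftrightarrow>
     (\<forall>i\<in>{1..m}. xs i \<in> carrier_vec (n i)) \<and> lams \<in> carrier_vec l \<and>
     (\<forall>lam\<in>carrier_vec l. lagrangian m l f A b xs lam \<le> lagrangian m l f A b xs lams) \<and>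
     (\<forall>x. (\<forall>i\<in>{1..m}. x i \<in> carrier_vec (n i)) \<longrightarrow>
        lagrangian m l f A b xs lams \<le> lagrangian m l f A b x lams)"

text \<open>
  The correction step produces blocks that need not lie in the ranges of the \<open>A\<^sub>i\<close>, so the \<open>i\<close>-th
  block of the iterate, denoted \<open>A\<^sub>i x\<^sub>i\<close> on paper, is an arbitrary vector \<open>y i\<close> of dimension \<open>l\<close>.
  The objective of the \<open>j\<close>-th subproblem is the augmented Lagrangian at
  \<open>(xt 1, \<dots>, xt (j - 1), x, x\<^sub>j\<^sub>+\<^sub>1, \<dots>, x\<^sub>m)\<close>, with \<open>y i\<close> in place of \<open>A\<^sub>i x\<^sub>i\<close> for \<open>i > j\<close> and without
  the terms \<open>f\<^sub>i\<close>, \<open>i \<noteq> j\<close>, which do not depend on \<open>x\<close>; see \<open>aug_lagrangian_eq_prediction_obj\<close>.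
\<close>

definition prediction_residual ::
  "nat \<Rightarrow> nat \<Rightarrow> (nat \<Rightarrow> real mat) \<Rightarrow> real vec \<Rightarrow> (nat \<Rightarrow> real vec) \<Rightarrow> (nat \<Rightarrow> real vec) \<Rightarrow>
   nat \<Rightarrow> real vec \<Rightarrow> real vec" where
  "prediction_residual m l A b xt y j x =
     finsum_vec TYPE(real) l
       (\<lambda>i. if i < j then A i *\<^sub>v xt i else if i = j then A j *\<^sub>v x else y i) {1..m} - b"

definition prediction_obj ::
  "nat \<Rightarrow> nat \<Rightarrow> (nat \<Rightarrow> real vec \<Rightarrow> real) \<Rightarrow> (nat \<Rightarrow> real mat) \<Rightarrow> real vec \<Rightarrow> real \<Rightarrow>
   (nat \<Rightarrow> real vec) \<Rightarrow> (nat \<Rightarrow> real vec) \<Rightarrow> real vec \<Rightarrow> nat \<Rightarrow> real vec \<Rightarrow> real" where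
  "prediction_obj m l f A b \<beta> xt y lam j x =
     f j x - lam \<bullet> prediction_residual m l A b xt y j x +
     \<beta> / 2 * (vnorm (prediction_residual m l A b xt y j x))\<^sup>2"

definition stack :: "nat \<Rightarrow> nat \<Rightarrow> (nat \<Rightarrow> real vec) \<Rightarrow> real vec \<Rightarrow> real vec" where
  \<comment> \<open>the vector \<open>(y\<^sub>2, \<dots>, y\<^sub>m, lam)\<close>\<close>
  "stack m l y lam = vec ((m - 1) * l) (\<lambda>i. y (i div l + 2) $ (i mod l)) @\<^sub>v lam"

definition Jmat :: "nat \<Rightarrow> nat \<Rightarrow> real mat" where
  "Jmat m l = mat ((m - 1) * l) ((m - 1) * l)
     (\<lambda>(i, j). (if j div l \<le> i div l then 1\<^sub>m l else 0\<^sub>m l l) $$ (i mod l, j mod l))"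

definition Itilde :: "nat \<Rightarrow> nat \<Rightarrow> real mat" where
  "Itilde m l = mat l ((m - 1) * l) (\<lambda>(i, j). 1\<^sub>m l $$ (i, j mod l))"

definition Pmat :: "nat \<Rightarrow> nat \<Rightarrow> real \<Rightarrow> real mat" where
  "Pmat m l \<beta> = four_block_mat
     (sqrt \<beta> \<cdot>\<^sub>m Jmat m l)      (0\<^sub>m ((m - 1) * l) l)
     (0\<^sub>m l ((m - 1) * l))       ((1 / sqrt \<beta>) \<cdot>\<^sub>m 1\<^sub>m l)"

definition Nmat :: "nat \<Rightarrow> nat \<Rightarrow> real \<Rightarrow> real \<Rightarrow> real mat" where
  "Nmat m l \<gamma> \<beta> = \<gamma> \<cdot>\<^sub>m four_block_mat
     (sqrt \<beta> \<cdot>\<^sub>m 1\<^sub>m ((m - 1) * l))  (0\<^sub>m ((m - 1) * l) l)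
     (- (sqrt \<beta> \<cdot>\<^sub>m Itilde m l))     ((1 / sqrt \<beta>) \<cdot>\<^sub>m 1\<^sub>m l)"

text \<open>
  For \<open>\<beta> > 0\<close> the matrix \<open>Pmat\<close> is block triangular with nonzero multiples of the identity on the
  diagonal, so \<open>mat_inverse\<close> returns \<open>Some\<close> inverse below.
\<close>

definition Mmat :: "nat \<Rightarrow> nat \<Rightarrow> real \<Rightarrow> real \<Rightarrow> real mat" where
  "Mmat m l \<gamma> \<beta> = the (mat_inverse (transpose_mat (Pmat m l \<beta>))) * Nmat m l \<gamma> \<beta>"

definition Qmat :: "nat \<Rightarrow> nat \<Rightarrow> real \<Rightarrow> real mat" where
  "Qmat m l \<beta> = four_block_mat
     (\<beta> \<cdot>\<^sub>m Jmat m l)   (0\<^sub>m ((m - 1) * l) l)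
     (- Itilde m l)     ((1 / \<beta>) \<cdot>\<^sub>m 1\<^sub>m l)"

definition Hmat :: "nat \<Rightarrow> nat \<Rightarrow> real \<Rightarrow> real \<Rightarrow> real mat" where
  "Hmat m l \<gamma> \<beta> = (1 / \<gamma>) \<cdot>\<^sub>m four_block_mat
     (\<beta> \<cdot>\<^sub>m (Jmat m l * transpose_mat (Jmat m l)))  (0\<^sub>m ((m - 1) * l) l)
     (0\<^sub>m l ((m - 1) * l))                           ((1 / \<beta>) \<cdot>\<^sub>m 1\<^sub>m l)"

definition Gmat :: "nat \<Rightarrow> nat \<Rightarrow> real \<Rightarrow> real \<Rightarrow> real mat" where
  "Gmat m l \<gamma> \<beta> = transpose_mat (Qmat m l \<beta>) + Qmat m l \<beta> -
     transpose_mat (Mmat m l \<gamma> \<beta>) * Hmat m l \<gamma> \<beta> * Mmat m l \<gamma> \<beta>"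

definition H0mat :: "nat \<Rightarrow> nat \<Rightarrow> real mat \<Rightarrow> real \<Rightarrow> real \<Rightarrow> real \<Rightarrow> real mat" where
  "H0mat m l Am L \<gamma> \<beta> = (1 / \<gamma>) \<cdot>\<^sub>m four_block_mat
     (Jmat m l * transpose_mat (Jmat m l))  (0\<^sub>m ((m - 1) * l) l)
     (0\<^sub>m l ((m - 1) * l))
     ((1 / \<beta>\<^sup>2 + (1 - \<gamma>) * (sigma_min (Am * transpose_mat Am) / (L * \<beta>))) \<cdot>\<^sub>m 1\<^sub>m l)"

definition CC3 ::
  "nat \<Rightarrow> (nat \<Rightarrow> real) \<Rightarrow> real \<Rightarrow> real mat \<Rightarrow> (nat \<Rightarrow> real mat) \<Rightarrow> (nat \<Rightarrow> real mat) \<Rightarrow>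
   (nat \<Rightarrow> real mat) \<Rightarrow> (nat \<Rightarrow> real) \<Rightarrow> (nat \<Rightarrow> real vec) \<Rightarrow> (nat \<Rightarrow> real vec) \<Rightarrow>
   (nat \<Rightarrow> real vec) \<Rightarrow> real vec \<Rightarrow> real vec \<Rightarrow> bool" where
  "CC3 d r \<sigma> R H G H0 \<Theta> v vt z v' z' \<longleftrightarrow>
     (\<forall>k. 0 < r k \<and> pos_semidef d (H0 k) \<and> 0 \<le> \<Theta> k \<and>
        r k * (qform (H k) (v (Suc k) - v') + \<sigma> * qform R (z k - z')
               - qform (H k) (v k - v') + qform (G k) (v k - vt k))
        \<ge> qform (H0 (Suc k)) (v (Suc k) - v') - qform (H0 k) (v k - v')
           + \<Theta> (Suc k) - \<Theta> k)"

lemma aug_lagrangian_eq_prediction_obj: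
  assumes j: "j \<in> {1..m}"
    and A: "\<And>i. i \<in> {1..m} \<Longrightarrow> A i \<in> carrier_mat l (n i)"
    and y: "\<And>i. i \<in> {j<..m} \<Longrightarrow> y i = A i *\<^sub>v xk i"
  shows "aug_lagrangian m l f A b \<beta> (\<lambda>i. if i < j then xt i else if i = j then x else xk i) lam =
         prediction_obj m l f A b \<beta> xt y lam j x +
         ((\<Sum>i\<in>{1..<j}. f i (xt i)) + (\<Sum>i\<in>{j<..m}. f i (xk i)))"
proof -
  let ?w = "\<lambda>i. if i < j then xt i else if i = j then x else xk i"
  let ?u = "\<lambda>i. if i < j then A i *\<^sub>v xt i else if i = j then A j *\<^sub>v x else y i"
  have eq: "A i *\<^sub>v ?w i = ?u i" if "i \<in> {1..m}" for i
    using that y by auto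
  have car: "A i *\<^sub>v ?w i \<in> carrier_vec l" if "i \<in> {1..m}" for i
    using A[OF that] by (intro carrier_vecI) simp
  have car': "?u i \<in> carrier_vec l" if "i \<in> {1..m}" for i
    using car[OF that] eq[OF that] by simp
  have fs: "finsum_vec TYPE(real) l (\<lambda>i. A i *\<^sub>v ?w i) {1..m} = finsum_vec TYPE(real) l ?u {1..m}"
    (is "?a = ?c")
  proof (rule eq_vecI)
    have 1: "?a \<in> carrier_vec l" "?c \<in> carrier_vec l"
      using car car' by (intro finsum_vec_closed; blast)+
    then show "dim_vec ?a = dim_vec ?c" by auto
    fix i assume "i < dim_vec ?c"
    then have i: "i < l" using 1 by auto
    have 2: "?a $ i = (\<Sum>k\<in>{1..m}. (A k *\<^sub>v ?w k) $ i)"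
      using car by (intro index_finsum_vec[OF _ i]) auto
    have 3: "?c $ i = (\<Sum>k\<in>{1..m}. ?u k $ i)"
      using car' by (intro index_finsum_vec[OF _ i]) blast+
    show "?a $ i = ?c $ i"
      unfolding 2 3 by (rule sum.cong[OF refl]) (simp add: eq)
  qed
  have split: "{1..m} = insert j ({1..<j} \<union> {j<..m})" using j by auto
  have "(\<Sum>i=1..m. f i (?w i)) = f j x + (\<Sum>i\<in>{1..<j} \<union> {j<..m}. f i (?w i))"
    unfolding split by (subst sum.insert) auto
  also have "(\<Sum>i\<in>{1..<j} \<union> {j<..m}. f i (?w i)) =
      (\<Sum>i\<in>{1..<j}. f i (?w i)) + (\<Sum>i\<in>{j<..m}. f i (?w i))"
    by (rule sum.union_disjoint) auto
  also have "(\<Sum>i\<in>{1..<j}. f i (?w i)) = (\<Sum>i\<in>{1..<j}. f i (xt i))" by simp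
  also have "(\<Sum>i\<in>{j<..m}. f i (?w i)) = (\<Sum>i\<in>{j<..m}. f i (xk i))"
    by (rule sum.cong) auto
  finally show ?thesis
    unfolding aug_lagrangian_def lagrangian_def prediction_obj_def prediction_residual_def fs
    by simp
qed

lemma has_gradient_unique:
  assumes x: "x \<in> carrier_vec n" and g: "has_gradient n f x g" and h: "has_gradient n f x h"
  shows "g = h"
proof (rule ccontr)
  assume "g \<noteq> h"
  have gc: "g \<in> carrier_vec n" and hc: "h \<in> carrier_vec n"
    using g h unfolding has_gradient_def by auto
  define u where "u = g - h"
  have uc: "u \<in> carrier_vec n" unfolding u_def using gc hc by auto
  have "u \<noteq> 0\<^sub>v n"
  proof
    assume u0: "u = 0\<^sub>v n"
    have "g $ i = h $ i" if "i < n" for i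
    proof -
      have "u $ i = g $ i - h $ i" unfolding u_def using that hc by auto
      then show ?thesis using u0 that by simp
    qed
    then show False using \<open>g \<noteq> h\<close> gc hc by (metis carrier_vecD eq_vecI)
  qed
  then obtain i where i: "i < n" "u $ i \<noteq> 0" using uc by (metis carrier_vecD eq_vecI index_zero_vec)
  have uu: "u \<bullet> u = (\<Sum>k<n. (u $ k)\<^sup>2)"
    using uc by (simp add: scalar_prod_def power2_eq_square lessThan_atLeast0)
  have "0 < (u $ i)\<^sup>2" using i by simp
  also have "\<dots> \<le> (\<Sum>k<n. (u $ k)\<^sup>2)" using i by (intro member_le_sum) auto
  finally have pos: "0 < u \<bullet> u" using uu by simp
  define N where "N = vnorm u"
  have N: "0 < N" "N * N = u \<bullet> u" unfolding N_def vnorm_def using pos by auto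
  obtain d1 where d1: "d1 > 0" "\<And>y. y \<in> carrier_vec n \<Longrightarrow> vnorm (y - x) < d1 \<Longrightarrow>
      \<bar>f y - f x - g \<bullet> (y - x)\<bar> \<le> N / 4 * vnorm (y - x)"
    using g N unfolding has_gradient_def by (metis divide_pos_pos zero_less_numeral)
  obtain d2 where d2: "d2 > 0" "\<And>y. y \<in> carrier_vec n \<Longrightarrow> vnorm (y - x) < d2 \<Longrightarrow>
      \<bar>f y - f x - h \<bullet> (y - x)\<bar> \<le> N / 4 * vnorm (y - x)"
    using h N unfolding has_gradient_def by (metis divide_pos_pos zero_less_numeral)
  define t where "t = min d1 d2 / (2 * N)"
  have t: "t > 0" "t * N < d1" "t * N < d2" unfolding t_def using d1 d2 N by (auto simp: min_def)
  define y where "y = x + t \<cdot>\<^sub>v u"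
  have yc: "y \<in> carrier_vec n" unfolding y_def using x uc by auto
  have yx: "y - x = t \<cdot>\<^sub>v u" unfolding y_def using x uc by (intro eq_vecI) auto
  have "(t \<cdot>\<^sub>v u) \<bullet> (t \<cdot>\<^sub>v u) = (t * N)\<^sup>2" using N uc by (simp add: power2_eq_square)
  then have vn: "vnorm (y - x) = t * N" unfolding yx vnorm_def using t N by simp
  have "\<bar>g \<bullet> (y - x) - h \<bullet> (y - x)\<bar> \<le> N / 4 * (t * N) + N / 4 * (t * N)"
    using d1(2)[OF yc] d2(2)[OF yc] t unfolding vn by linarith
  moreover have "g \<bullet> (y - x) - h \<bullet> (y - x) = t * (u \<bullet> u)"
  proof -
    have "g \<bullet> (y - x) - h \<bullet> (y - x) = t * (g \<bullet> u - h \<bullet> u)"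
      unfolding yx using gc hc uc by (simp add: algebra_simps)
    also have "g \<bullet> u - h \<bullet> u = u \<bullet> u"
      using minus_scalar_prod_distrib[OF gc hc uc] unfolding u_def by simp
    finally show ?thesis .
  qed
  ultimately have "t * (N * N) \<le> N / 4 * (t * N) + N / 4 * (t * N)"
    unfolding N(2) by linarith
  moreover have "N / 4 * (t * N) + N / 4 * (t * N) = t * (N * N) / 2" by simp
  moreover have "0 < t * (N * N)" using t N(1) by simp
  ultimately show False by linarith
qed

end

theory Submission
  imports Defs
begin

text \<open>
  Fix an iteration, write \<open>\<beta>, \<lambda>, y\<^sub>j\<close> for the current data and \<open>\<lambda>\<^sup>+\<close> for the next multiplier, and put
  \<open>w = \<lambda> - \<beta> (\<Sum>\<^sub>i A\<^sub>i xt\<^sub>i - b)\<close>, the multiplier belonging to the predicted point. Three facts link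
  \<open>w\<close> to the iteration.

  \<^item> Stationarity in the last subproblem says that the gradient of \<open>f\<^sub>m\<close> at \<open>xt\<^sub>m\<close> is \<open>A\<^sub>m\<^sup>T w\<close>
    (\<open>gradient_at_last_prediction\<close>), and at a saddle point it is \<open>A\<^sub>m\<^sup>T \<lambda>\<^sup>*\<close>
    (\<open>gradient_at_saddle_point\<close>).
  \<^item> Consequently the gradient term of the condition dominates \<open>\<sigma> \<parallel>w - \<lambda>\<^sup>*\<parallel>\<^sup>2\<close>, where \<open>\<sigma>\<close> is the smallest
    eigenvalue of \<open>A\<^sub>m A\<^sub>m\<^sup>T\<close> (\<open>sigma_min_mult_transpose\<close>).
  \<^item> The correction step acts on the multiplier as \<open>\<lambda>\<^sup>+ = (1 - \<gamma>) \<lambda> + \<gamma> w\<close> (\<open>Mmat_mult_vec\<close>), so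
    \<open>\<parallel>\<lambda>\<^sup>+ - \<lambda>\<^sup>*\<parallel>\<^sup>2 \<le> (1 - \<gamma>) \<parallel>\<lambda> - \<lambda>\<^sup>*\<parallel>\<^sup>2 + \<gamma> \<parallel>w - \<lambda>\<^sup>*\<parallel>\<^sup>2\<close>.

  The leading blocks of \<open>H\<^sup>k / \<beta>\<^sup>k\<close>, \<open>H\<^sub>0\<^sup>k\<close> and \<open>H\<^sub>0\<^sup>k\<^sup>+\<^sup>1\<close> are all equal to \<open>J J\<^sup>T / \<gamma>\<close>, so what the \<open>y\<^sub>j\<close>
  contribute through these matrices cancels, and the quadratic form of \<open>G\<^sup>k\<close> is nonnegative
  (\<open>qform_Gmat\<close>). There remains an inequality between the squared multiplier errors. The condition
  on the \<open>\<beta>\<^sup>k\<close> replaces the coefficient of \<open>\<parallel>\<lambda>\<^sup>+ - \<lambda>\<^sup>*\<parallel>\<^sup>2\<close> by \<open>1 / \<beta>\<^sup>2 + \<sigma> / (L \<beta>)\<close>, after which the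
  three facts above give exactly what is needed (\<open>descent_arithmetic\<close>).
\<close>

section \<open>Real vectors and matrices\<close>

lemma scalar_prod_eq_sum:
  "w \<in> carrier_vec n \<Longrightarrow> v \<bullet> w = (\<Sum>i<n. v $ i * w $ i)"
  by (simp add: scalar_prod_def lessThan_atLeast0)

lemma scalar_prod_self_nonneg: "0 \<le> v \<bullet> (v :: real vec)"
  by (simp add: scalar_prod_def sum_nonneg)

lemma vnorm_power2: "(vnorm v)\<^sup>2 = v \<bullet> v"
  by (simp add: vnorm_def scalar_prod_self_nonneg)

lemma scalar_prod_self_pos:
  fixes v :: "real vec"
  assumes "v \<in> carrier_vec n" "v \<noteq> 0\<^sub>v n"
  shows "0 < v \<bullet> v"
  using conjugate_square_greater_0_vec[OF assms(1)] assms(2)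
  by (simp add: conjugate_vec_def scalar_prod_def)

text \<open>
  Expand the nonnegative number \<open>\<parallel>(a \<bullet> a) u - (a \<bullet> u) a\<parallel>\<^sup>2\<close>.
\<close>

lemma scalar_prod_Cauchy_Schwarz:
  fixes a u :: "real vec"
  assumes a: "a \<in> carrier_vec n" and u: "u \<in> carrier_vec n"
  shows "(a \<bullet> u)\<^sup>2 \<le> (a \<bullet> a) * (u \<bullet> u)"
proof (cases "a = 0\<^sub>v n")
  case True
  then show ?thesis using u by simp
next
  case False
  then have pos: "0 < a \<bullet> a" using scalar_prod_self_pos[OF a] by simp
  define Q r where "Q = a \<bullet> a" and "r = a \<bullet> u"
  have "0 \<le> (\<Sum>i<n. (Q * u $ i - r * a $ i)\<^sup>2)" by (simp add: sum_nonneg)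
  also have "\<dots> = (\<Sum>i<n. Q\<^sup>2 * (u $ i * u $ i) - 2 * Q * r * (a $ i * u $ i) + r\<^sup>2 * (a $ i * a $ i))"
    by (rule sum.cong) (auto simp: power2_eq_square algebra_simps)
  also have "\<dots> = Q\<^sup>2 * (u \<bullet> u) - 2 * Q * r * (a \<bullet> u) + r\<^sup>2 * (a \<bullet> a)"
    unfolding scalar_prod_eq_sum[OF u] scalar_prod_eq_sum[OF a]
    by (simp add: sum.distrib sum_subtractf sum_distrib_left)
  also have "\<dots> = Q * (Q * (u \<bullet> u) - r\<^sup>2)"
    unfolding Q_def[symmetric] r_def[symmetric] by (simp add: power2_eq_square algebra_simps)
  finally show ?thesis using pos unfolding Q_def r_def by (simp add: zero_le_mult_iff)
qed

lemma mult_mat_vec_bound: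
  fixes B :: "real mat"
  assumes B: "B \<in> carrier_mat nr nc"
  obtains K where "0 \<le> K" "\<And>u :: real vec. u \<in> carrier_vec nc \<Longrightarrow> (B *\<^sub>v u) \<bullet> (B *\<^sub>v u) \<le> K * (u \<bullet> u)"
proof
  define K where "K = (\<Sum>i<nr. row B i \<bullet> row B i)"
  show "0 \<le> K" unfolding K_def by (simp add: sum_nonneg scalar_prod_self_nonneg)
  fix u :: "real vec" assume u: "u \<in> carrier_vec nc"
  have "(B *\<^sub>v u) \<bullet> (B *\<^sub>v u) = (\<Sum>i<nr. (row B i \<bullet> u)\<^sup>2)"
    using B mult_mat_vec_carrier[OF B u]
    by (subst scalar_prod_eq_sum[of _ nr]) (auto simp: power2_eq_square)
  also have "\<dots> \<le> (\<Sum>i<nr. (row B i \<bullet> row B i) * (u \<bullet> u))"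
    using B u by (intro sum_mono scalar_prod_Cauchy_Schwarz[of _ nc]) auto
  finally show "(B *\<^sub>v u) \<bullet> (B *\<^sub>v u) \<le> K * (u \<bullet> u)"
    unfolding K_def by (simp add: sum_distrib_right)
qed

lemma scalar_prod_add_self:
  fixes u v :: "real vec"
  assumes "u \<in> carrier_vec n" "v \<in> carrier_vec n"
  shows "(u + v) \<bullet> (u + v) = u \<bullet> u + 2 * (u \<bullet> v) + v \<bullet> v"
  using assms comm_scalar_prod[of v n u]
  by (simp add: scalar_prod_add_distrib[of _ n] add_scalar_prod_distrib[of _ n])

text \<open>
  The difference of the two sides is \<open>t (1 - t) \<parallel>p - q\<parallel>\<^sup>2\<close>.
\<close>

lemma convex_combination_scalar_prod_self:
  fixes p q :: "real vec"
  assumes p: "p \<in> carrier_vec n" and q: "q \<in> carrier_vec n" and "0 \<le> t" "t \<le> 1"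
  shows "((1 - t) \<cdot>\<^sub>v p + t \<cdot>\<^sub>v q) \<bullet> ((1 - t) \<cdot>\<^sub>v p + t \<cdot>\<^sub>v q) \<le> (1 - t) * (p \<bullet> p) + t * (q \<bullet> q)"
proof -
  have "0 \<le> t * (1 - t) * ((p - q) \<bullet> (p - q))"
    using assms by (intro mult_nonneg_nonneg scalar_prod_self_nonneg) auto
  also have "(p - q) \<bullet> (p - q) = p \<bullet> p - 2 * (p \<bullet> q) + q \<bullet> q"
    using p q comm_scalar_prod[OF p q]
    by (simp add: scalar_prod_minus_distrib[of _ n] minus_scalar_prod_distrib[of _ n])
  finally show ?thesis
    using p q by (subst scalar_prod_add_self[of _ n]) (auto simp: algebra_simps)
qed

lemma smult_mat_mult_vec:
  fixes A :: "real mat"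
  assumes "A \<in> carrier_mat nr nc" "v \<in> carrier_vec nc"
  shows "(k \<cdot>\<^sub>m A) *\<^sub>v v = k \<cdot>\<^sub>v (A *\<^sub>v v)"
  using assms by (intro eq_vecI) auto

lemma transpose_smult_mat: "transpose_mat (k \<cdot>\<^sub>m A) = k \<cdot>\<^sub>m transpose_mat A"
  by (intro eq_matI) auto

lemma zero_mat_mult_vec:
  "v \<in> carrier_vec nc \<Longrightarrow> 0\<^sub>m nr nc *\<^sub>v v = (0\<^sub>v nr :: real vec)"
  by (intro eq_vecI) auto

lemma append_vec_diff:
  fixes a b c d :: "'a :: ab_group_add vec"
  assumes "a \<in> carrier_vec p" "b \<in> carrier_vec p" "c \<in> carrier_vec q" "d \<in> carrier_vec q"
  shows "(a @\<^sub>v c) - (b @\<^sub>v d) = (a - b) @\<^sub>v (c - d)"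
  using assms by (intro eq_vecI) (auto simp: append_vec_def)

lemma add_diff_vec_commute:
  fixes s t b :: "real vec"
  assumes "s \<in> carrier_vec n" "t \<in> carrier_vec n" "b \<in> carrier_vec n"
  shows "s + t - b = t - b + s"
  using assms by (intro eq_vecI) auto

lemma finsum_vec_cong:
  fixes g h :: "'a \<Rightarrow> 'b :: comm_monoid_add vec"
  assumes "finite F" "\<And>i. i \<in> F \<Longrightarrow> g i = h i" "\<And>i. i \<in> F \<Longrightarrow> h i \<in> carrier_vec n"
  shows "finsum_vec TYPE('b) n g F = finsum_vec TYPE('b) n h F"
proof (rule eq_vecI)
  have c: "finsum_vec TYPE('b) n g F \<in> carrier_vec n" "finsum_vec TYPE('b) n h F \<in> carrier_vec n"
    using assms by (auto intro!: finsum_vec_closed)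
  then show "dim_vec (finsum_vec TYPE('b) n g F) = dim_vec (finsum_vec TYPE('b) n h F)" by simp
  fix i assume "i < dim_vec (finsum_vec TYPE('b) n h F)"
  then have "i < n" using c by simp
  then show "finsum_vec TYPE('b) n g F $ i = finsum_vec TYPE('b) n h F $ i"
    using assms by (subst (1 2) index_finsum_vec) (auto intro!: sum.cong)
qed

section \<open>The smallest eigenvalue as a lower bound of the quadratic form\<close>

text \<open>
  Moving from \<open>x\<close> a short way in the direction \<open>- B x\<close> cannot make the form negative, which yields
  \<open>x \<bullet> B x \<ge> \<parallel>B x\<parallel>\<^sup>2 / C\<close>; invertibility bounds \<open>\<parallel>B x\<parallel>\<close> below by a multiple of \<open>\<parallel>x\<parallel>\<close>. This
  substitutes for a compactness argument on the unit sphere.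
\<close>

lemma pos_def_of_pos_semidef_det:
  fixes B :: "real mat"
  assumes B: "B \<in> carrier_mat n n" and sym: "transpose_mat B = B"
    and psd: "\<And>x. x \<in> carrier_vec n \<Longrightarrow> 0 \<le> x \<bullet> (B *\<^sub>v x)"
    and det: "det B \<noteq> 0"
  obtains c where "0 < c" "\<And>x :: real vec. x \<in> carrier_vec n \<Longrightarrow> c * (x \<bullet> x) \<le> x \<bullet> (B *\<^sub>v x)"
proof -
  obtain B' where B': "B' \<in> carrier_mat n n" "B' * B = 1\<^sub>m n"
    using det_non_zero_imp_unit[OF B det, of undefined] unfolding Units_def ring_mat_def by auto
  obtain K where K: "0 \<le> K" "\<And>u. u \<in> carrier_vec n \<Longrightarrow> (B *\<^sub>v u) \<bullet> (B *\<^sub>v u) \<le> K * (u \<bullet> u)"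
    using mult_mat_vec_bound[OF B] by blast
  obtain K' where K': "0 \<le> K'" "\<And>u. u \<in> carrier_vec n \<Longrightarrow> (B' *\<^sub>v u) \<bullet> (B' *\<^sub>v u) \<le> K' * (u \<bullet> u)"
    using mult_mat_vec_bound[OF B'(1)] by blast
  define C where "C = K + 1"
  have C: "C \<ge> 1" using K(1) unfolding C_def by simp
  have qb: "z \<bullet> (B *\<^sub>v z) \<le> C * (z \<bullet> z)" if z: "z \<in> carrier_vec n" for z
  proof -
    have bz: "B *\<^sub>v z \<in> carrier_vec n" using B z by (rule mult_mat_vec_carrier)
    have "0 \<le> (z + (- 1) \<cdot>\<^sub>v (B *\<^sub>v z)) \<bullet> (z + (- 1) \<cdot>\<^sub>v (B *\<^sub>v z))" by (rule scalar_prod_self_nonneg)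
    also have "\<dots> = z \<bullet> z - 2 * (z \<bullet> (B *\<^sub>v z)) + (B *\<^sub>v z) \<bullet> (B *\<^sub>v z)"
      using z bz by (subst scalar_prod_add_self[of _ n]) auto
    finally have "2 * (z \<bullet> (B *\<^sub>v z)) \<le> z \<bullet> z + K * (z \<bullet> z)" using K(2)[OF z] by linarith
    moreover have "0 \<le> K * (z \<bullet> z)" "0 \<le> z \<bullet> z"
      using K(1) scalar_prod_self_nonneg[of z] by auto
    ultimately show ?thesis unfolding C_def by (simp add: algebra_simps)
  qed
  show ?thesis
  proof
    show "0 < 1 / (C * (K' + 1))" using C K'(1) by simp
    fix x :: "real vec" assume x: "x \<in> carrier_vec n"
    define p where "p = B *\<^sub>v x"
    have p: "p \<in> carrier_vec n" unfolding p_def using B x by (rule mult_mat_vec_carrier)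
    define q where "q = B *\<^sub>v p"
    have q: "q \<in> carrier_vec n" unfolding q_def using B p by (rule mult_mat_vec_carrier)
    \<comment> \<open>the step length minimizing \<open>2 t (p \<bullet> p) + C t\<^sup>2 (p \<bullet> p)\<close>\<close>
    define t where "t = - (1 / C)"
    have xq: "x \<bullet> q = p \<bullet> p"
      unfolding q_def using transpose_vec_mult_scalar[OF B p x] sym unfolding p_def by (metis B comm_scalar_prod mult_mat_vec_carrier p p_def x)
    have "0 \<le> (x + t \<cdot>\<^sub>v p) \<bullet> (B *\<^sub>v (x + t \<cdot>\<^sub>v p))" using x p by (intro psd) auto
    also have "B *\<^sub>v (x + t \<cdot>\<^sub>v p) = p + t \<cdot>\<^sub>v q"
      using B x p unfolding p_def q_def by (simp add: mult_add_distrib_mat_vec mult_mat_vec)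
    also have "(x + t \<cdot>\<^sub>v p) \<bullet> (p + t \<cdot>\<^sub>v q) = x \<bullet> p + 2 * t * (p \<bullet> p) + t * t * (p \<bullet> q)"
      using x p q xq
      by (simp add: scalar_prod_add_distrib[of _ n] add_scalar_prod_distrib[of _ n] algebra_simps)
    also have "\<dots> \<le> x \<bullet> p + 2 * t * (p \<bullet> p) + t * t * (C * (p \<bullet> p))"
      using qb[OF p] unfolding q_def by (intro add_left_mono mult_left_mono) auto
    also have "\<dots> = x \<bullet> p - (p \<bullet> p) / C"
      using C unfolding t_def by (simp add: field_simps)
    finally have 1: "(p \<bullet> p) / C \<le> x \<bullet> p" by simp
    have "x = B' *\<^sub>v p"
      using B' B x unfolding p_def by (subst assoc_mult_mat_vec[symmetric, of _ n n _ n]) auto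
    then have "x \<bullet> x \<le> K' * (p \<bullet> p)" using K'(2)[OF p] by simp
    also have "\<dots> \<le> (K' + 1) * (p \<bullet> p)" using scalar_prod_self_nonneg[of p] by (intro mult_right_mono) auto
    finally have "x \<bullet> x \<le> (K' + 1) * (p \<bullet> p)" .
    then have "1 / (C * (K' + 1)) * (x \<bullet> x) \<le> 1 / (C * (K' + 1)) * ((K' + 1) * (p \<bullet> p))"
      using C K'(1) by (intro mult_left_mono) auto
    also have "\<dots> = (p \<bullet> p) / C"
    proof -
      have "K' + 1 \<noteq> 0" using K'(1) by linarith
      then show ?thesis by simp
    qed
    finally show "1 / (C * (K' + 1)) * (x \<bullet> x) \<le> x \<bullet> (B *\<^sub>v x)" using 1 unfolding p_def by linarith
  qed
qed

lemma qform_mult_transpose: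
  fixes A :: "real mat"
  assumes A: "A \<in> carrier_mat l n" and w: "w \<in> carrier_vec l"
  shows "w \<bullet> (A * transpose_mat A *\<^sub>v w) = (transpose_mat A *\<^sub>v w) \<bullet> (transpose_mat A *\<^sub>v w)"
proof -
  have "A * transpose_mat A *\<^sub>v w = A *\<^sub>v (transpose_mat A *\<^sub>v w)"
    using A w by (intro assoc_mult_mat_vec[of _ l n _ l]) auto
  then show ?thesis
    using transpose_vec_mult_scalar[OF A _ w, of "transpose_mat A *\<^sub>v w"] A w
    by (simp add: mult_mat_vec_carrier[of _ n l])
qed

text \<open>
  Let \<open>t\<^sub>0\<close> be the largest \<open>t\<close> for which the form of \<open>D - t I\<close> is nonnegative. Were \<open>D - t\<^sub>0 I\<close>
  invertible, its form would be bounded below by \<open>c \<parallel>x\<parallel>\<^sup>2\<close> with \<open>c > 0\<close> and \<open>t\<^sub>0\<close> could be enlarged.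
  So \<open>t\<^sub>0\<close> is an eigenvalue. In particular the spectrum over the reals is nonempty, and its minimum
  is at most \<open>t\<^sub>0\<close>.
\<close>

lemma sigma_min_lower_bound:
  fixes D :: "real mat"
  assumes D: "D \<in> carrier_mat n n" and n: "0 < n" and sym: "transpose_mat D = D"
    and psd: "\<And>x. x \<in> carrier_vec n \<Longrightarrow> 0 \<le> x \<bullet> (D *\<^sub>v x)"
  shows "sigma_min D \<in> spectrum D"
    and "\<And>x. x \<in> carrier_vec n \<Longrightarrow> sigma_min D * (x \<bullet> x) \<le> x \<bullet> (D *\<^sub>v x)"
proof -
  define S where "S = {t. \<forall>x\<in>carrier_vec n. t * (x \<bullet> x) \<le> x \<bullet> (D *\<^sub>v x)}"
  have S0: "0 \<in> S" using psd unfolding S_def by auto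
  have bdd: "bdd_above S"
  proof
    fix t assume "t \<in> S"
    then show "t \<le> unit_vec n 0 \<bullet> (D *\<^sub>v unit_vec n 0)"
      using n unfolding S_def by (auto dest!: bspec[of _ _ "unit_vec n 0"])
  qed
  define t0 where "t0 = Sup S"
  have t0: "t0 * (x \<bullet> x) \<le> x \<bullet> (D *\<^sub>v x)" if x: "x \<in> carrier_vec n" for x
  proof (cases "x = 0\<^sub>v n")
    case True
    then show ?thesis using D by simp
  next
    case False
    then have pos: "0 < x \<bullet> x" by (rule scalar_prod_self_pos[OF x])
    have "t0 \<le> (x \<bullet> (D *\<^sub>v x)) / (x \<bullet> x)" unfolding t0_def
    proof (rule cSup_least)
      show "S \<noteq> {}" using S0 by auto
    qed (use pos x in \<open>auto simp: S_def pos_le_divide_eq\<close>)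
    then show ?thesis using pos by (simp add: field_simps)
  qed
  define B where "B = char_matrix D t0"
  have B: "B \<in> carrier_mat n n" unfolding B_def using D by simp
  have Bsym: "transpose_mat B = B"
    unfolding B_def char_matrix_def
  proof (rule eq_matI, goal_cases)
    case (1 i j)
    then have ij: "i < n" "j < n" using D by auto
    have "D $$ (j, i) = D $$ (i, j)"
      using arg_cong[OF sym, of "\<lambda>M. M $$ (i, j)"] D ij by simp
    then show ?case using D ij by auto
  qed (use D in auto)
  have Bq: "x \<bullet> (B *\<^sub>v x) = x \<bullet> (D *\<^sub>v x) - t0 * (x \<bullet> x)" if x: "x \<in> carrier_vec n" for x
  proof -
    have "B *\<^sub>v x = D *\<^sub>v x + (- t0) \<cdot>\<^sub>v x"
      unfolding B_def char_matrix_def using D x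
      by (intro eq_vecI) (auto simp: add_scalar_prod_distrib[of _ n])
    then show ?thesis using D x by (simp add: scalar_prod_add_distrib[of _ n])
  qed
  have "det B = 0"
  proof (rule ccontr)
    assume "det B \<noteq> 0"
    then obtain c where c: "0 < c" "\<And>x :: real vec. x \<in> carrier_vec n \<Longrightarrow> c * (x \<bullet> x) \<le> x \<bullet> (B *\<^sub>v x)"
      using pos_def_of_pos_semidef_det[OF B Bsym] Bq t0 by (metis diff_ge_0_iff_ge)
    have "t0 + c \<in> S" unfolding S_def using c(2) Bq by (force simp: algebra_simps)
    then have "t0 + c \<le> t0" unfolding t0_def using bdd by (rule cSup_upper)
    then show False using c(1) by simp
  qed
  then have "t0 \<in> spectrum D"
    unfolding spectrum_def using eigenvalue_det[OF D] B_def by simp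
  moreover have "finite (spectrum D)" using card_finite_spectrum[OF D] by simp
  ultimately show "sigma_min D \<in> spectrum D" and le: "\<And>x. x \<in> carrier_vec n \<Longrightarrow> sigma_min D * (x \<bullet> x) \<le> x \<bullet> (D *\<^sub>v x)"
    unfolding sigma_min_def
    by (auto intro!: Min_in order_trans[OF mult_right_mono[OF Min_le] t0] scalar_prod_self_nonneg)
qed

text \<open>
  Both parts come from \<open>w \<bullet> (A A\<^sup>T w) = \<parallel>A\<^sup>T w\<parallel>\<^sup>2\<close>. For \<open>l = 0\<close> the spectrum is empty and \<open>sigma_min\<close> has no definite value; the inequality then
  reads \<open>0 \<le> 0\<close>, but the sign of \<open>sigma_min\<close> is only known for \<open>l > 0\<close>.
\<close>

lemma sigma_min_mult_transpose:
  fixes A :: "real mat"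
  assumes A: "A \<in> carrier_mat l n" and w: "w \<in> carrier_vec l"
  shows "sigma_min (A * transpose_mat A) * (w \<bullet> w)
      \<le> (transpose_mat A *\<^sub>v w) \<bullet> (transpose_mat A *\<^sub>v w)"
    and "0 < l \<Longrightarrow> 0 \<le> sigma_min (A * transpose_mat A)"
proof -
  let ?D = "A * transpose_mat A"
  have D: "?D \<in> carrier_mat l l" using A by simp
  have sym: "transpose_mat ?D = ?D" using A by (simp add: transpose_mult[of _ l n])
  have psd: "0 \<le> x \<bullet> (?D *\<^sub>v x)" if "x \<in> carrier_vec l" for x
    unfolding qform_mult_transpose[OF A that] by (rule scalar_prod_self_nonneg)
  show "sigma_min ?D * (w \<bullet> w) \<le> (transpose_mat A *\<^sub>v w) \<bullet> (transpose_mat A *\<^sub>v w)"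
  proof (cases "l = 0")
    case True
    then show ?thesis using w A by (simp add: scalar_prod_def sum_nonneg)
  next
    case False
    then show ?thesis
      using sigma_min_lower_bound(2)[OF D _ sym psd w] qform_mult_transpose[OF A w] by simp
  qed
  show "0 \<le> sigma_min ?D" if l: "0 < l"
  proof -
    obtain x where x: "x \<in> carrier_vec l" "x \<noteq> 0\<^sub>v l" "?D *\<^sub>v x = sigma_min ?D \<cdot>\<^sub>v x"
      using sigma_min_lower_bound(1)[OF D l sym psd] A
      unfolding spectrum_def eigenvalue_def eigenvector_def by auto
    have "0 \<le> sigma_min ?D * (x \<bullet> x)" using psd[OF x(1)] x by simp
    then show ?thesis using scalar_prod_self_pos[OF x(1,2)] by (simp add: zero_le_mult_iff)
  qed
qed

section \<open>Gradients at minimizers\<close>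

text \<open>
  First-order optimality in one-sided form: a quadratic lower model that touches \<open>f\<close> at \<open>x\<close> has slope
  equal to the gradient there. Otherwise a short step along \<open>h - g\<close> would violate the lower bound,
  since its quadratic term is of second order in the step.
\<close>

lemma has_gradient_eqI:
  assumes g: "has_gradient n f x g" and x: "x \<in> carrier_vec n" and h: "h \<in> carrier_vec n"
    and low: "\<And>z. z \<in> carrier_vec n \<Longrightarrow> h \<bullet> (z - x) - C * ((z - x) \<bullet> (z - x)) \<le> f z - f x"
  shows "g = h"
proof (rule ccontr)
  assume "g \<noteq> h"
  have gc: "g \<in> carrier_vec n" using g unfolding has_gradient_def by auto
  define u where "u = h - g"
  have uc: "u \<in> carrier_vec n" unfolding u_def using gc h by auto
  have "u \<noteq> 0\<^sub>v n"
  proof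
    assume u0: "u = 0\<^sub>v n"
    have "h $ i = g $ i" if "i < n" for i
    proof -
      have "u $ i = h $ i - g $ i" unfolding u_def using that gc by auto
      then show ?thesis using u0 that by simp
    qed
    then show False using \<open>g \<noteq> h\<close> gc h by (metis carrier_vecD eq_vecI)
  qed
  then have pos: "0 < u \<bullet> u" by (rule scalar_prod_self_pos[OF uc])
  define N where "N = vnorm u"
  have N: "0 < N" "N * N = u \<bullet> u" unfolding N_def vnorm_def using pos by auto
  obtain d where d: "d > 0" "\<And>z. z \<in> carrier_vec n \<Longrightarrow> vnorm (z - x) < d \<Longrightarrow>
      \<bar>f z - f x - g \<bullet> (z - x)\<bar> \<le> N / 4 * vnorm (z - x)"
    using g N unfolding has_gradient_def by (metis divide_pos_pos zero_less_numeral)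
  \<comment> \<open>short enough for the gradient estimate with error \<open>N / 4\<close> to apply
  and for the quadratic term to cost at most a quarter of the linear gain\<close>
  define t where "t = min (d / (2 * N)) (1 / (4 * (\<bar>C\<bar> + 1)))"
  have t: "t > 0" unfolding t_def using d N by (auto simp: min_def)
  have tN: "t * N < d"
  proof -
    have "t * N \<le> d / (2 * N) * N" unfolding t_def using N by (intro mult_right_mono) auto
    also have "\<dots> < d" using N d by simp
    finally show ?thesis .
  qed
  have tC: "C * t \<le> 1 / 4"
  proof -
    have "C * t \<le> (\<bar>C\<bar> + 1) * (1 / (4 * (\<bar>C\<bar> + 1)))"
      using t unfolding t_def by (intro mult_mono) auto
    also have "\<dots> = 1 / 4" using abs_ge_zero[of C] by (simp add: field_simps)
    finally show ?thesis .
  qed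
  define z where "z = x + t \<cdot>\<^sub>v u"
  have zc: "z \<in> carrier_vec n" unfolding z_def using x uc by auto
  have zx: "z - x = t \<cdot>\<^sub>v u" unfolding z_def using x uc by (intro eq_vecI) auto
  have sq: "(z - x) \<bullet> (z - x) = t * t * (u \<bullet> u)" unfolding zx using uc by simp
  have vn: "vnorm (z - x) = t * N"
    unfolding vnorm_def sq using t N(1) by (simp add: N(2)[symmetric] real_sqrt_mult)
  have "h \<bullet> (z - x) - C * (t * t * (u \<bullet> u)) \<le> g \<bullet> (z - x) + N / 4 * (t * N)"
    using d(2)[OF zc] low[OF zc] tN unfolding vn sq by linarith
  moreover have "h \<bullet> (z - x) - g \<bullet> (z - x) = t * (u \<bullet> u)"
  proof -
    have "h \<bullet> (z - x) - g \<bullet> (z - x) = t * (h \<bullet> u - g \<bullet> u)"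
      unfolding zx using gc h uc by (simp add: algebra_simps)
    also have "h \<bullet> u - g \<bullet> u = u \<bullet> u"
      using minus_scalar_prod_distrib[OF h gc uc] unfolding u_def by simp
    finally show ?thesis .
  qed
  ultimately have "t * (u \<bullet> u) \<le> C * t * (t * (u \<bullet> u)) + 1 / 4 * (t * (u \<bullet> u))"
    by (simp add: N(2)[symmetric] algebra_simps)
  also have "\<dots> \<le> 1 / 4 * (t * (u \<bullet> u)) + 1 / 4 * (t * (u \<bullet> u))"
    using tC t pos by (intro add_mono mult_right_mono) auto
  also have "\<dots> < t * (u \<bullet> u)" using mult_pos_pos[OF t pos] by linarith
  finally show False by simp
qed

lemma gradient_eqI:
  assumes "has_gradient n f x g" "x \<in> carrier_vec n"
  shows "gradient n f x = g"
  unfolding gradient_def using assms by (blast intro: has_gradient_unique)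

text \<open>
  Stationarity for \<open>\<phi> z - lam \<bullet> (c + A z) + \<beta> / 2 * \<parallel>c + A z\<parallel>\<^sup>2\<close>. Expanding the penalty at the minimizer
  gives a lower model of \<open>\<phi>\<close> whose linear part is the claimed gradient and whose quadratic part is
  controlled by a bound on \<open>A\<close>. With \<open>\<beta> = 0\<close> this is also the stationarity condition of the ordinary
  Lagrangian.
\<close>

lemma gradient_of_quadratic_penalty_minimizer:
  fixes \<phi> :: "real vec \<Rightarrow> real" and A :: "real mat"
  assumes A: "A \<in> carrier_mat l n" and c: "c \<in> carrier_vec l" and lam: "lam \<in> carrier_vec l"
    and x: "x \<in> carrier_vec n" and g: "has_gradient n \<phi> x g"
    and min: "\<And>z. z \<in> carrier_vec n \<Longrightarrow>
        \<phi> x - lam \<bullet> (c + A *\<^sub>v x) + \<beta> / 2 * (vnorm (c + A *\<^sub>v x))\<^sup>2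
      \<le> \<phi> z - lam \<bullet> (c + A *\<^sub>v z) + \<beta> / 2 * (vnorm (c + A *\<^sub>v z))\<^sup>2"
  shows "g = transpose_mat A *\<^sub>v (lam - \<beta> \<cdot>\<^sub>v (c + A *\<^sub>v x))"
proof -
  obtain K where K: "0 \<le> K" "\<And>u :: real vec. u \<in> carrier_vec n \<Longrightarrow> (A *\<^sub>v u) \<bullet> (A *\<^sub>v u) \<le> K * (u \<bullet> u)"
    using mult_mat_vec_bound[OF A] by blast
  define p where "p = c + A *\<^sub>v x"
  have p: "p \<in> carrier_vec l" unfolding p_def using c mult_mat_vec_carrier[OF A x] by simp
  define w where "w = lam - \<beta> \<cdot>\<^sub>v p"
  have w: "w \<in> carrier_vec l" unfolding w_def using lam p by simp
  have At: "transpose_mat A *\<^sub>v w \<in> carrier_vec n"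
    using A w by (auto intro: mult_mat_vec_carrier)
  have "g = transpose_mat A *\<^sub>v w"
  proof (rule has_gradient_eqI[OF g x At])
    fix z :: "real vec" assume z: "z \<in> carrier_vec n"
    define u where "u = z - x"
    have u: "u \<in> carrier_vec n" unfolding u_def using x z by simp
    define q where "q = A *\<^sub>v u"
    have q: "q \<in> carrier_vec l" unfolding q_def using A u by (rule mult_mat_vec_carrier)
    have "A *\<^sub>v z = A *\<^sub>v x + q"
    proof -
      have "z = x + u" unfolding u_def using x z by (intro eq_vecI) auto
      then show ?thesis unfolding q_def using mult_add_distrib_mat_vec[OF A x u] by simp
    qed
    then have pz: "c + A *\<^sub>v z = p + q"
      unfolding p_def using c q mult_mat_vec_carrier[OF A x] by simp
    have "\<phi> x - lam \<bullet> p + \<beta> / 2 * (p \<bullet> p)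
        \<le> \<phi> z - lam \<bullet> (p + q) + \<beta> / 2 * ((p + q) \<bullet> (p + q))"
      using min[OF z] unfolding vnorm_power2 pz p_def[symmetric] .
    then have "lam \<bullet> q - \<beta> * (p \<bullet> q) - \<beta> / 2 * (q \<bullet> q) \<le> \<phi> z - \<phi> x"
      unfolding scalar_prod_add_self[OF p q] using lam p q
      by (simp add: scalar_prod_add_distrib[of _ l] algebra_simps)
    moreover have "\<beta> / 2 * (q \<bullet> q) \<le> \<bar>\<beta>\<bar> / 2 * K * (u \<bullet> u)"
    proof -
      have "\<beta> / 2 * (q \<bullet> q) \<le> \<bar>\<beta>\<bar> / 2 * (q \<bullet> q)"
        using scalar_prod_self_nonneg[of q] by (intro mult_right_mono) auto
      also have "\<dots> \<le> \<bar>\<beta>\<bar> / 2 * (K * (u \<bullet> u))"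
        using K(2)[OF u] unfolding q_def by (intro mult_left_mono) auto
      finally show ?thesis by simp
    qed
    moreover have "(transpose_mat A *\<^sub>v w) \<bullet> u = lam \<bullet> q - \<beta> * (p \<bullet> q)"
      using transpose_vec_mult_scalar[OF A u w] lam p q unfolding w_def q_def[symmetric]
      by (simp add: minus_scalar_prod_distrib[of _ l])
    ultimately show "(transpose_mat A *\<^sub>v w) \<bullet> (z - x)
        - \<bar>\<beta>\<bar> / 2 * K * ((z - x) \<bullet> (z - x)) \<le> \<phi> z - \<phi> x"
      unfolding u_def[symmetric] by linarith
  qed
  then show ?thesis unfolding w_def p_def .
qed

text \<open>
  Vary only the \<open>i\<close>-th block of the primal point: the Lagrangian becomes an instance of the
  penalized objective with \<open>\<beta> = 0\<close>.
\<close>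

lemma gradient_at_saddle_point:
  assumes m: "i \<in> {1..m}" and A: "\<And>i. i \<in> {1..m} \<Longrightarrow> A i \<in> carrier_mat l (n i)"
    and b: "b \<in> carrier_vec l"
    and sp: "is_saddle_point m l n f A b xs lams" and g: "has_gradient (n i) (f i) (xs i) g"
  shows "g = transpose_mat (A i) *\<^sub>v lams"
proof -
  have xs: "\<And>j. j \<in> {1..m} \<Longrightarrow> xs j \<in> carrier_vec (n j)" and lams: "lams \<in> carrier_vec l"
    and min: "\<And>x. (\<And>j. j \<in> {1..m} \<Longrightarrow> x j \<in> carrier_vec (n j)) \<Longrightarrow>
        lagrangian m l f A b xs lams \<le> lagrangian m l f A b x lams"
    using sp unfolding is_saddle_point_def by auto
  note Ai = A[OF m] and xi = xs[OF m]
  let ?F = "{1..m} - {i}"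
  define c where "c = finsum_vec TYPE(real) l (\<lambda>j. A j *\<^sub>v xs j) ?F - b"
  have Ax: "A j *\<^sub>v xs j \<in> carrier_vec l" if "j \<in> {1..m}" for j
    using A[OF that] xs[OF that] by (rule mult_mat_vec_carrier)
  have sc: "finsum_vec TYPE(real) l (\<lambda>j. A j *\<^sub>v xs j) ?F \<in> carrier_vec l"
    using Ax by (intro finsum_vec_closed) auto
  have c: "c \<in> carrier_vec l" unfolding c_def using b sc by simp
  have ins: "{1..m} = insert i ?F" using m by auto
  have lag: "lagrangian m l f A b (xs(i := z)) lams
      = f i z - lams \<bullet> (c + A i *\<^sub>v z) + (\<Sum>j\<in>?F. f j (xs j))" if z: "z \<in> carrier_vec (n i)" for z :: "real vec"
  proof -
    have Az: "A i *\<^sub>v z \<in> carrier_vec l" using Ai z by (rule mult_mat_vec_carrier)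
    have "finsum_vec TYPE(real) l (\<lambda>j. A j *\<^sub>v (xs(i := z)) j) {1..m}
        = A i *\<^sub>v z + finsum_vec TYPE(real) l (\<lambda>j. A j *\<^sub>v (xs(i := z)) j) ?F"
      using Ax Az by (subst ins, subst finsum_vec_insert) auto
    also have "finsum_vec TYPE(real) l (\<lambda>j. A j *\<^sub>v (xs(i := z)) j) ?F
        = finsum_vec TYPE(real) l (\<lambda>j. A j *\<^sub>v xs j) ?F"
      using Ax by (intro finsum_vec_cong) auto
    finally have "finsum_vec TYPE(real) l (\<lambda>j. A j *\<^sub>v (xs(i := z)) j) {1..m} - b = c + A i *\<^sub>v z"
      unfolding c_def using add_diff_vec_commute[OF Az sc b] by simp
    moreover have "(\<Sum>j=1..m. f j ((xs(i := z)) j)) = f i z + (\<Sum>j\<in>?F. f j (xs j))"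
      by (subst ins, subst sum.insert) auto
    ultimately show ?thesis unfolding lagrangian_def by simp
  qed
  have "g = transpose_mat (A i) *\<^sub>v (lams - 0 \<cdot>\<^sub>v (c + A i *\<^sub>v xs i))"
  proof (rule gradient_of_quadratic_penalty_minimizer[OF Ai c lams xi g])
    fix z :: "real vec" assume z: "z \<in> carrier_vec (n i)"
    have "lagrangian m l f A b (xs(i := xs i)) lams \<le> lagrangian m l f A b (xs(i := z)) lams"
      using min[of "xs(i := z)"] xs z by simp
    then show "f i (xs i) - lams \<bullet> (c + A i *\<^sub>v xs i) + 0 / 2 * (vnorm (c + A i *\<^sub>v xs i))\<^sup>2
        \<le> f i z - lams \<bullet> (c + A i *\<^sub>v z) + 0 / 2 * (vnorm (c + A i *\<^sub>v z))\<^sup>2"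
      unfolding lag[OF z] lag[OF xi] by simp
  qed
  also have "lams - 0 \<cdot>\<^sub>v (c + A i *\<^sub>v xs i) = lams"
  proof -
    have "c + A i *\<^sub>v xs i \<in> carrier_vec l" using c Ax[OF m] by simp
    then show ?thesis using lams by (intro eq_vecI) (auto simp del: index_add_vec)
  qed
  finally show ?thesis .
qed

text \<open>
  In the subproblem of the last block no \<open>y\<^sub>j\<close> occurs: its residual consists of predicted blocks
  only. Hence the multiplier on the right-hand side is formed with the full predicted point.
\<close>

lemma gradient_at_last_prediction:
  assumes m: "2 \<le> m" and A: "\<And>i. i \<in> {1..m} \<Longrightarrow> A i \<in> carrier_mat l (n i)"
    and b: "b \<in> carrier_vec l" and lam: "lam \<in> carrier_vec l"
    and xt: "\<And>i. i \<in> {1..m} \<Longrightarrow> xt i \<in> carrier_vec (n i)"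
    and min: "is_arg_min (prediction_obj m l f A b \<beta> xt y lam m) (\<lambda>x. x \<in> carrier_vec (n m)) (xt m)"
    and g: "has_gradient (n m) (f m) (xt m) g"
  shows "g = transpose_mat (A m) *\<^sub>v
    (lam - \<beta> \<cdot>\<^sub>v (A 1 *\<^sub>v xt 1 + finsum_vec TYPE(real) l (\<lambda>i. A i *\<^sub>v xt i) {2..m} - b))"
proof -
  have mm: "m \<in> {1..m}" using m by simp
  note Am = A[OF mm] and xm = xt[OF mm]
  have Ax: "A i *\<^sub>v xt i \<in> carrier_vec l" if "i \<in> {1..m}" for i
    using A[OF that] xt[OF that] by (rule mult_mat_vec_carrier)
  define c where "c = finsum_vec TYPE(real) l (\<lambda>i. A i *\<^sub>v xt i) {1..<m} - b"
  have sc: "finsum_vec TYPE(real) l (\<lambda>i. A i *\<^sub>v xt i) {1..<m} \<in> carrier_vec l"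
    using Ax by (intro finsum_vec_closed) auto
  have c: "c \<in> carrier_vec l" unfolding c_def using b sc by simp
  have ins: "{1..m} = insert m {1..<m}" using m by auto
  have res: "prediction_residual m l A b xt y m z = c + A m *\<^sub>v z" if z: "z \<in> carrier_vec (n m)" for z :: "real vec"
  proof -
    let ?h = "\<lambda>i. if i < m then A i *\<^sub>v xt i else if i = m then A m *\<^sub>v z else y i"
    have Az: "A m *\<^sub>v z \<in> carrier_vec l" using Am z by (rule mult_mat_vec_carrier)
    have "finsum_vec TYPE(real) l ?h {1..m} = A m *\<^sub>v z + finsum_vec TYPE(real) l ?h {1..<m}"
      unfolding ins using Ax Az by (subst finsum_vec_insert) auto
    also have "finsum_vec TYPE(real) l ?h {1..<m} = finsum_vec TYPE(real) l (\<lambda>i. A i *\<^sub>v xt i) {1..<m}"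
      using Ax by (intro finsum_vec_cong) auto
    finally show ?thesis
      unfolding prediction_residual_def c_def using add_diff_vec_commute[OF Az sc b] by simp
  qed
  have "g = transpose_mat (A m) *\<^sub>v (lam - \<beta> \<cdot>\<^sub>v (c + A m *\<^sub>v xt m))"
  proof (rule gradient_of_quadratic_penalty_minimizer[OF Am c lam xm g])
    fix z :: "real vec" assume z: "z \<in> carrier_vec (n m)"
    have "prediction_obj m l f A b \<beta> xt y lam m (xt m) \<le> prediction_obj m l f A b \<beta> xt y lam m z"
      using min z unfolding is_arg_min_def by (auto simp: not_less)
    then show "f m (xt m) - lam \<bullet> (c + A m *\<^sub>v xt m) + \<beta> / 2 * (vnorm (c + A m *\<^sub>v xt m))\<^sup>2
        \<le> f m z - lam \<bullet> (c + A m *\<^sub>v z) + \<beta> / 2 * (vnorm (c + A m *\<^sub>v z))\<^sup>2"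
      unfolding prediction_obj_def res[OF z] res[OF xm] .
  qed
  also have "c + A m *\<^sub>v xt m = A 1 *\<^sub>v xt 1 + finsum_vec TYPE(real) l (\<lambda>i. A i *\<^sub>v xt i) {2..m} - b"
  proof -
    have "{1..m} = insert 1 {2..m}" using m by auto
    then have "finsum_vec TYPE(real) l (\<lambda>i. A i *\<^sub>v xt i) {1..m}
        = A 1 *\<^sub>v xt 1 + finsum_vec TYPE(real) l (\<lambda>i. A i *\<^sub>v xt i) {2..m}"
      using Ax m by (simp add: finsum_vec_insert)
    moreover have "finsum_vec TYPE(real) l (\<lambda>i. A i *\<^sub>v xt i) {1..m}
        = A m *\<^sub>v xt m + finsum_vec TYPE(real) l (\<lambda>i. A i *\<^sub>v xt i) {1..<m}"
      unfolding ins using Ax m by (subst finsum_vec_insert) auto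
    moreover have "c + A m *\<^sub>v xt m
        = A m *\<^sub>v xt m + finsum_vec TYPE(real) l (\<lambda>i. A i *\<^sub>v xt i) {1..<m} - b"
      unfolding c_def by (rule add_diff_vec_commute[OF Ax[OF mm] sc b, symmetric])
    ultimately show ?thesis by simp
  qed
  finally show ?thesis .
qed

section \<open>The block matrices of the method\<close>

lemma qform_block_diag:
  assumes X: "X \<in> carrier_mat N N" and a: "a \<in> carrier_vec N" and e: "e \<in> carrier_vec l"
  shows "qform (r \<cdot>\<^sub>m four_block_mat X (0\<^sub>m N l) (0\<^sub>m l N) (q \<cdot>\<^sub>m 1\<^sub>m l)) (a @\<^sub>v e)
    = r * (a \<bullet> (X *\<^sub>v a) + q * (e \<bullet> e))"
proof -
  have Xa: "X *\<^sub>v a \<in> carrier_vec N" using X a by (rule mult_mat_vec_carrier)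
  have "four_block_mat X (0\<^sub>m N l) (0\<^sub>m l N) (q \<cdot>\<^sub>m 1\<^sub>m l) *\<^sub>v (a @\<^sub>v e) = (X *\<^sub>v a) @\<^sub>v (q \<cdot>\<^sub>v e)"
    using X a e Xa
    by (subst four_block_mat_mult_vec[of _ N N _ l _ l]) (auto simp: smult_mat_mult_vec[of _ l l])
  then have "(r \<cdot>\<^sub>m four_block_mat X (0\<^sub>m N l) (0\<^sub>m l N) (q \<cdot>\<^sub>m 1\<^sub>m l)) *\<^sub>v (a @\<^sub>v e)
      = r \<cdot>\<^sub>v ((X *\<^sub>v a) @\<^sub>v (q \<cdot>\<^sub>v e))"
    using X a e by (subst smult_mat_mult_vec[of _ "N + l" "N + l"]) auto
  then show ?thesis unfolding qform_def
    using a e Xa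
    by (simp add: scalar_prod_smult_distrib[of _ "N + l"] scalar_prod_append[of _ N _ l])
qed

text \<open>
  The Gauss-Jordan inversion succeeds on every matrix with nonzero determinant, so the inverse in
  the definition of \<open>Mmat\<close> can be used.
\<close>

lemma mat_inverse_Some_of_det:
  fixes A :: "'a :: field mat"
  assumes A: "A \<in> carrier_mat n n" and det: "det A \<noteq> 0"
  obtains B where "mat_inverse A = Some B"
  using mat_inverse(1)[OF A, of "()"] det_non_zero_imp_unit[OF A det, of "()"]
  by (cases "mat_inverse A") auto

context
  fixes m l N :: nat
  defines "N \<equiv> (m - 1) * l"
begin

lemma Jmat_carrier: "Jmat m l \<in> carrier_mat N N"
  unfolding Jmat_def N_def by simp

lemma Itilde_carrier: "Itilde m l \<in> carrier_mat l N"
  unfolding Itilde_def N_def by simp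

lemma block_index:
  assumes "i < N"
  shows "0 < l" "i mod l < l"
proof -
  show "0 < l" using assms unfolding N_def by (cases l) auto
  then show "i mod l < l" by simp
qed

text \<open>
  Off the block diagonal exactly one of \<open>J\<close> and \<open>J\<^sup>T\<close> has the block \<open>I\<close>, on it both have; the product
  on the right has the block \<open>I\<close> everywhere.
\<close>

lemma Jmat_add_transpose:
  "Jmat m l + transpose_mat (Jmat m l) = 1\<^sub>m N + transpose_mat (Itilde m l) * Itilde m l"
proof (rule eq_matI)
  fix i j assume "i < dim_row (1\<^sub>m N + transpose_mat (Itilde m l) * Itilde m l)"
    and "j < dim_col (1\<^sub>m N + transpose_mat (Itilde m l) * Itilde m l)"
  then have ij: "i < N" "j < N" using Itilde_carrier by auto
  note l = block_index[OF ij(1)] block_index[OF ij(2)]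
  have "(transpose_mat (Itilde m l) * Itilde m l) $$ (i, j)
      = (\<Sum>k<l. Itilde m l $$ (k, i) * Itilde m l $$ (k, j))"
    using ij Itilde_carrier by (simp add: scalar_prod_def lessThan_atLeast0)
  also have "\<dots> = (\<Sum>k<l. if k = i mod l then (if i mod l = j mod l then 1 else 0) else 0)"
    using ij l by (intro sum.cong) (auto simp: Itilde_def N_def)
  also have "\<dots> = (if i mod l = j mod l then 1 else 0)" using l by simp
  finally have "(transpose_mat (Itilde m l) * Itilde m l) $$ (i, j) = (if i mod l = j mod l then 1 else 0)" .
  moreover have "i = j \<longleftrightarrow> i div l = j div l \<and> i mod l = j mod l"
    by (metis div_mult_mod_eq)
  ultimately show "(Jmat m l + transpose_mat (Jmat m l)) $$ (i, j)
      = (1\<^sub>m N + transpose_mat (Itilde m l) * Itilde m l) $$ (i, j)"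
    using ij l Jmat_carrier Itilde_carrier by (auto simp: Jmat_def N_def[symmetric])
qed (use Jmat_carrier Itilde_carrier in auto)

lemma Jmat_quadratic:
  assumes a: "a \<in> carrier_vec N"
  shows "2 * (a \<bullet> (Jmat m l *\<^sub>v a)) = a \<bullet> a + (Itilde m l *\<^sub>v a) \<bullet> (Itilde m l *\<^sub>v a)"
proof -
  let ?J = "Jmat m l" and ?I = "Itilde m l"
  note J = Jmat_carrier and I = Itilde_carrier
  have Ja: "?J *\<^sub>v a \<in> carrier_vec N" using J a by (rule mult_mat_vec_carrier)
  have Jta: "transpose_mat ?J *\<^sub>v a \<in> carrier_vec N" using J a by (auto intro: mult_mat_vec_carrier)
  have Ia: "?I *\<^sub>v a \<in> carrier_vec l" using I a by (rule mult_mat_vec_carrier)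
  have Ita: "transpose_mat ?I *\<^sub>v (?I *\<^sub>v a) \<in> carrier_vec N" using I Ia by (auto intro: mult_mat_vec_carrier)
  have "a \<bullet> ((?J + transpose_mat ?J) *\<^sub>v a) = 2 * (a \<bullet> (?J *\<^sub>v a))"
    using J a Ja Jta transpose_vec_mult_scalar[OF J a a] comm_scalar_prod[OF Jta a]
    by (simp add: add_mult_distrib_mat_vec[of _ N N] scalar_prod_add_distrib[of _ N])
  moreover have "a \<bullet> ((1\<^sub>m N + transpose_mat ?I * ?I) *\<^sub>v a) = a \<bullet> a + (?I *\<^sub>v a) \<bullet> (?I *\<^sub>v a)"
    using I a Ia Ita transpose_vec_mult_scalar[OF I a Ia] comm_scalar_prod[OF Ita a]
    by (simp add: add_mult_distrib_mat_vec[of _ N N] scalar_prod_add_distrib[of _ N]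
        assoc_mult_mat_vec[of _ N l _ N])
  ultimately show ?thesis unfolding Jmat_add_transpose by simp
qed

lemma qform_Hmat:
  assumes a: "a \<in> carrier_vec N" and e: "e \<in> carrier_vec l"
  shows "qform (Hmat m l \<gamma> \<beta>) (a @\<^sub>v e) =
    1 / \<gamma> * (\<beta> * ((transpose_mat (Jmat m l) *\<^sub>v a) \<bullet> (transpose_mat (Jmat m l) *\<^sub>v a)) + 1 / \<beta> * (e \<bullet> e))"
proof -
  note J = Jmat_carrier
  let ?X = "Jmat m l * transpose_mat (Jmat m l)"
  have X: "?X \<in> carrier_mat N N" using J by simp
  have "qform (Hmat m l \<gamma> \<beta>) (a @\<^sub>v e) = 1 / \<gamma> * (a \<bullet> ((\<beta> \<cdot>\<^sub>m ?X) *\<^sub>v a) + 1 / \<beta> * (e \<bullet> e))"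
    unfolding Hmat_def N_def[symmetric] using X a e by (intro qform_block_diag) auto
  moreover have "?X *\<^sub>v a \<in> carrier_vec N" using X a by (rule mult_mat_vec_carrier)
  ultimately show ?thesis
    using X a qform_mult_transpose[OF J a] by (simp add: smult_mat_mult_vec[of _ N N])
qed

lemma qform_H0mat:
  assumes a: "a \<in> carrier_vec N" and e: "e \<in> carrier_vec l"
  shows "qform (H0mat m l Am L \<gamma> \<beta>) (a @\<^sub>v e) =
    1 / \<gamma> * ((transpose_mat (Jmat m l) *\<^sub>v a) \<bullet> (transpose_mat (Jmat m l) *\<^sub>v a)
      + (1 / \<beta>\<^sup>2 + (1 - \<gamma>) * (sigma_min (Am * transpose_mat Am) / (L * \<beta>))) * (e \<bullet> e))"
proof -
  have "Jmat m l * transpose_mat (Jmat m l) \<in> carrier_mat N N" using Jmat_carrier by simp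
  then show ?thesis
    unfolding H0mat_def N_def[symmetric]
    by (subst qform_block_diag) (use a e qform_mult_transpose[OF Jmat_carrier a] in auto)
qed

lemma Pmat_carrier: "Pmat m l \<beta> \<in> carrier_mat (N + l) (N + l)"
  unfolding Pmat_def N_def[symmetric] using Jmat_carrier by simp

text \<open>
  \<open>Pmat\<close> is lower triangular not only blockwise but entrywise, as its nonzero blocks are multiples of
  the identity; its diagonal entries are \<open>sqrt \<beta>\<close> and \<open>1 / sqrt \<beta>\<close>.
\<close>

lemma det_Pmat:
  assumes \<beta>: "0 < \<beta>"
  shows "det (Pmat m l \<beta>) \<noteq> 0"
proof -
  have "det (Pmat m l \<beta>) = prod_list (diag_mat (Pmat m l \<beta>))"
  proof (rule det_lower_triangular[OF _ Pmat_carrier])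
    fix i j assume ij: "i < j" "j < N + l"
    show "Pmat m l \<beta> $$ (i, j) = 0"
    proof (cases "j < N")
      case True
      have "\<not> (j div l \<le> i div l \<and> i mod l = j mod l)"
      proof
        assume h: "j div l \<le> i div l \<and> i mod l = j mod l"
        then have "i div l = j div l" using div_le_mono[of i j l] ij by simp
        then have "i = j" using h by (metis div_mult_mod_eq)
        then show False using ij by simp
      qed
      then show ?thesis using ij True block_index[OF True] Jmat_carrier
        unfolding Pmat_def N_def[symmetric] by (auto simp: Jmat_def N_def[symmetric])
    next
      case False
      then show ?thesis using ij carrier_matD[OF Jmat_carrier]
        unfolding Pmat_def N_def[symmetric] by auto
    qed
  qed
  moreover have "Pmat m l \<beta> $$ (i, i) \<noteq> 0" if i: "i < N + l" for i
  proof (cases "i < N")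
    case True
    then show ?thesis using \<beta> block_index[OF True] Jmat_carrier
      unfolding Pmat_def N_def[symmetric] by (auto simp: Jmat_def N_def[symmetric])
  next
    case False
    then show ?thesis using \<beta> i Jmat_carrier
      unfolding Pmat_def N_def[symmetric] by (auto simp: Jmat_def N_def[symmetric])
  qed
  ultimately show ?thesis using Pmat_carrier[of \<beta>] by (auto simp: prod_list_zero_iff diag_mat_def)
qed

lemma Nmat_carrier: "Nmat m l \<gamma> \<beta> \<in> carrier_mat (N + l) (N + l)"
  unfolding Nmat_def N_def[symmetric] by simp

lemma Mmat_eq_inverse_mult:
  assumes \<beta>: "0 < \<beta>"
  obtains B where "B \<in> carrier_mat (N + l) (N + l)"
    "transpose_mat (Pmat m l \<beta>) * B = 1\<^sub>m (N + l)" "Mmat m l \<gamma> \<beta> = B * Nmat m l \<gamma> \<beta>"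
proof -
  have PT: "transpose_mat (Pmat m l \<beta>) \<in> carrier_mat (N + l) (N + l)" using Pmat_carrier by simp
  obtain B where "mat_inverse (transpose_mat (Pmat m l \<beta>)) = Some B"
    using mat_inverse_Some_of_det[OF PT] det_transpose[OF Pmat_carrier] det_Pmat[OF \<beta>] by metis
  then show ?thesis using that[of B] mat_inverse(2)[OF PT] unfolding Mmat_def by auto
qed

text \<open>
  The product \<open>M d\<close> is the solution of the system \<open>P\<^sup>T (M d) = N d\<close>, whose lower half gives the change
  of the multiplier explicitly. The upper half determines \<open>J\<^sup>T u\<close>, and since \<open>H\<close> sees the upper block only
  through \<open>J\<^sup>T\<close>, that is all one has to know about \<open>u\<close>.
\<close>

lemma Mmat_mult_vec:
  assumes \<beta>: "0 < \<beta>" and a: "a \<in> carrier_vec N" and e: "e \<in> carrier_vec l"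
  obtains u where "u \<in> carrier_vec N"
    "Mmat m l \<gamma> \<beta> *\<^sub>v (a @\<^sub>v e) = u @\<^sub>v (\<gamma> \<cdot>\<^sub>v (e - \<beta> \<cdot>\<^sub>v (Itilde m l *\<^sub>v a)))"
    "transpose_mat (Jmat m l) *\<^sub>v u = \<gamma> \<cdot>\<^sub>v a"
proof -
  note J = Jmat_carrier and I = Itilde_carrier
  have J': "transpose_mat (Jmat m l) \<in> carrier_mat N N" using J by simp
  let ?PT = "transpose_mat (Pmat m l \<beta>)"
  note Nm = Nmat_carrier[of \<gamma> \<beta>]
  have PT: "?PT \<in> carrier_mat (N + l) (N + l)" using Pmat_carrier by simp
  obtain B where B: "?PT * B = 1\<^sub>m (N + l)" "B \<in> carrier_mat (N + l) (N + l)"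
    and M: "Mmat m l \<gamma> \<beta> = B * Nmat m l \<gamma> \<beta>"
    using Mmat_eq_inverse_mult[OF \<beta>, of \<gamma>] by metis
  define d where "d = a @\<^sub>v e"
  have d: "d \<in> carrier_vec (N + l)" unfolding d_def using a e by simp
  define w where "w = Mmat m l \<gamma> \<beta> *\<^sub>v d"
  have w: "w \<in> carrier_vec (N + l)"
    unfolding w_def M using B Nm d by (auto intro: mult_mat_vec_carrier)
  have Nd: "Nmat m l \<gamma> \<beta> *\<^sub>v d \<in> carrier_vec (N + l)" using Nm d by (rule mult_mat_vec_carrier)
  have "?PT *\<^sub>v w = ?PT *\<^sub>v (B *\<^sub>v (Nmat m l \<gamma> \<beta> *\<^sub>v d))"
    unfolding w_def M using B Nm d by (subst assoc_mult_mat_vec[of _ "N+l" "N+l" _ "N+l"]) auto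
  also have "\<dots> = ?PT * B *\<^sub>v (Nmat m l \<gamma> \<beta> *\<^sub>v d)"
    using B PT Nd by (subst assoc_mult_mat_vec[of _ "N+l" "N+l" _ "N+l"]) auto
  also have "\<dots> = Nmat m l \<gamma> \<beta> *\<^sub>v d" unfolding B(1) using Nd by simp
  finally have PTw: "?PT *\<^sub>v w = Nmat m l \<gamma> \<beta> *\<^sub>v d" .
  define u u' where "u = vec_first w N" and "u' = vec_last w l"
  have u: "u \<in> carrier_vec N" "u' \<in> carrier_vec l" unfolding u_def u'_def by auto
  have wu: "w = u @\<^sub>v u'" unfolding u_def u'_def using w by simp
  define Ia where "Ia = Itilde m l *\<^sub>v a"
  have Ia: "Ia \<in> carrier_vec l" unfolding Ia_def using I a by (rule mult_mat_vec_carrier)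
  have Jtu: "transpose_mat (Jmat m l) *\<^sub>v u \<in> carrier_vec N" using J' u(1) by (rule mult_mat_vec_carrier)
  have PTu: "?PT *\<^sub>v w = (sqrt \<beta> \<cdot>\<^sub>v (transpose_mat (Jmat m l) *\<^sub>v u)) @\<^sub>v ((1 / sqrt \<beta>) \<cdot>\<^sub>v u')"
  proof -
    have "?PT = four_block_mat (sqrt \<beta> \<cdot>\<^sub>m transpose_mat (Jmat m l)) (0\<^sub>m N l) (0\<^sub>m l N) ((1 / sqrt \<beta>) \<cdot>\<^sub>m 1\<^sub>m l)"
      unfolding Pmat_def N_def[symmetric] using J
      by (subst transpose_four_block_mat[of _ N N _ l _ l]) (auto simp: transpose_smult_mat)
    then show ?thesis unfolding wu using J' u Jtu
      by (simp add: zero_mat_mult_vec[of _ l] zero_mat_mult_vec[of _ N] four_block_mat_mult_vec[of _ N N _ l _ l] smult_mat_mult_vec[of _ N N] smult_mat_mult_vec[of _ l l])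
  qed
  have Ndu: "Nmat m l \<gamma> \<beta> *\<^sub>v d
      = (\<gamma> \<cdot>\<^sub>v (sqrt \<beta> \<cdot>\<^sub>v a)) @\<^sub>v (\<gamma> \<cdot>\<^sub>v (- (sqrt \<beta> \<cdot>\<^sub>v Ia) + (1 / sqrt \<beta>) \<cdot>\<^sub>v e))"
  proof -
    have um: "- (sqrt \<beta> \<cdot>\<^sub>m Itilde m l) *\<^sub>v a = - (sqrt \<beta> \<cdot>\<^sub>v Ia)"
      unfolding Ia_def using I a by (simp add: smult_mat_mult_vec[of _ l N])
    have "four_block_mat (sqrt \<beta> \<cdot>\<^sub>m 1\<^sub>m N) (0\<^sub>m N l) (- (sqrt \<beta> \<cdot>\<^sub>m Itilde m l)) ((1 / sqrt \<beta>) \<cdot>\<^sub>m 1\<^sub>m l) *\<^sub>v d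
        = (sqrt \<beta> \<cdot>\<^sub>v a) @\<^sub>v (- (sqrt \<beta> \<cdot>\<^sub>v Ia) + (1 / sqrt \<beta>) \<cdot>\<^sub>v e)"
      unfolding d_def using a e I Ia
      by (simp add: zero_mat_mult_vec[of _ l] four_block_mat_mult_vec[of _ N N _ l _ l] um smult_mat_mult_vec[of _ N N] smult_mat_mult_vec[of _ l l])
    then have "Nmat m l \<gamma> \<beta> *\<^sub>v d = \<gamma> \<cdot>\<^sub>v ((sqrt \<beta> \<cdot>\<^sub>v a) @\<^sub>v (- (sqrt \<beta> \<cdot>\<^sub>v Ia) + (1 / sqrt \<beta>) \<cdot>\<^sub>v e))"
      unfolding Nmat_def N_def[symmetric] using d I
      by (subst smult_mat_mult_vec[of _ "N + l" "N + l"]) auto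
    also have "\<dots> = (\<gamma> \<cdot>\<^sub>v (sqrt \<beta> \<cdot>\<^sub>v a)) @\<^sub>v (\<gamma> \<cdot>\<^sub>v (- (sqrt \<beta> \<cdot>\<^sub>v Ia) + (1 / sqrt \<beta>) \<cdot>\<^sub>v e))"
      using a e Ia by (intro eq_vecI) (auto simp: append_vec_def)
    finally show ?thesis .
  qed
  have eqs: "sqrt \<beta> \<cdot>\<^sub>v (transpose_mat (Jmat m l) *\<^sub>v u) = \<gamma> \<cdot>\<^sub>v (sqrt \<beta> \<cdot>\<^sub>v a)"
    "(1 / sqrt \<beta>) \<cdot>\<^sub>v u' = \<gamma> \<cdot>\<^sub>v (- (sqrt \<beta> \<cdot>\<^sub>v Ia) + (1 / sqrt \<beta>) \<cdot>\<^sub>v e)"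
    using PTw[unfolded PTu Ndu] append_vec_eq[of "sqrt \<beta> \<cdot>\<^sub>v (transpose_mat (Jmat m l) *\<^sub>v u)" N "\<gamma> \<cdot>\<^sub>v (sqrt \<beta> \<cdot>\<^sub>v a)"] Jtu a
    by auto
  have "transpose_mat (Jmat m l) *\<^sub>v u = \<gamma> \<cdot>\<^sub>v a"
  proof -
    have "(1 / sqrt \<beta>) \<cdot>\<^sub>v (sqrt \<beta> \<cdot>\<^sub>v (transpose_mat (Jmat m l) *\<^sub>v u)) = (1 / sqrt \<beta>) \<cdot>\<^sub>v (\<gamma> \<cdot>\<^sub>v (sqrt \<beta> \<cdot>\<^sub>v a))"
      using eqs(1) by simp
    then show ?thesis using \<beta> Jtu a by (simp add: smult_smult_assoc)
  qed
  moreover have "u' = \<gamma> \<cdot>\<^sub>v (e - \<beta> \<cdot>\<^sub>v Ia)"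
  proof (rule eq_vecI)
    fix i assume "i < dim_vec (\<gamma> \<cdot>\<^sub>v (e - \<beta> \<cdot>\<^sub>v Ia))"
    then have i: "i < l" using Ia by simp
    have "1 / sqrt \<beta> * u' $ i = \<gamma> * (- (sqrt \<beta> * Ia $ i) + 1 / sqrt \<beta> * e $ i)"
      using arg_cong[OF eqs(2), of "\<lambda>v. v $ i"] i u e Ia by simp
    then have "u' $ i = \<gamma> * (e $ i - (sqrt \<beta> * sqrt \<beta>) * Ia $ i)"
      using \<beta> by (simp add: field_simps del: real_sqrt_mult_self)
    then show "u' $ i = (\<gamma> \<cdot>\<^sub>v (e - \<beta> \<cdot>\<^sub>v Ia)) $ i" using \<beta> i e Ia by simp
  qed (use u Ia in simp)
  ultimately show ?thesis using that[of u] u wu unfolding w_def d_def Ia_def by simp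
qed

text \<open>
  This is a sum of nonnegative terms for \<open>0 \<le> \<gamma> \<le> 1\<close>. It results from
  \<open>d \<bullet> G d = 2 (d \<bullet> Q d) - (M d) \<bullet> H (M d)\<close>, where the first term is evaluated by
  \<open>Jmat_quadratic\<close> and the second one by \<open>Mmat_mult_vec\<close>.
\<close>

lemma qform_Gmat:
  assumes \<beta>: "0 < \<beta>" and \<gamma>: "0 < \<gamma>" and a: "a \<in> carrier_vec N" and e: "e \<in> carrier_vec l"
  shows "qform (Gmat m l \<gamma> \<beta>) (a @\<^sub>v e) =
    (1 - \<gamma>) * (\<beta> * (a \<bullet> a) + (e - \<beta> \<cdot>\<^sub>v (Itilde m l *\<^sub>v a)) \<bullet> (e - \<beta> \<cdot>\<^sub>v (Itilde m l *\<^sub>v a)) / \<beta>) + (e \<bullet> e) / \<beta>"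
proof -
  note J = Jmat_carrier and I = Itilde_carrier
  define s where "s = Itilde m l *\<^sub>v a"
  have s: "s \<in> carrier_vec l" unfolding s_def using I a by (rule mult_mat_vec_carrier)
  have Ja: "Jmat m l *\<^sub>v a \<in> carrier_vec N" using J a by (rule mult_mat_vec_carrier)
  define r where "r = e - \<beta> \<cdot>\<^sub>v s"
  have r: "r \<in> carrier_vec l" unfolding r_def using e s by simp
  obtain u where u: "u \<in> carrier_vec N" "Mmat m l \<gamma> \<beta> *\<^sub>v (a @\<^sub>v e) = u @\<^sub>v (\<gamma> \<cdot>\<^sub>v r)"
    "transpose_mat (Jmat m l) *\<^sub>v u = \<gamma> \<cdot>\<^sub>v a"
    using Mmat_mult_vec[OF \<beta> a e, of \<gamma>] unfolding r_def s_def by blast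
  define d where "d = a @\<^sub>v e"
  have d: "d \<in> carrier_vec (N + l)" unfolding d_def using a e by simp
  let ?n = "N + l" and ?M = "Mmat m l \<gamma> \<beta>" and ?H = "Hmat m l \<gamma> \<beta>" and ?Q = "Qmat m l \<beta>"
  have Q: "?Q \<in> carrier_mat ?n ?n" unfolding Qmat_def N_def[symmetric] using J by simp
  have QT: "transpose_mat ?Q \<in> carrier_mat ?n ?n" using Q by simp
  have H: "?H \<in> carrier_mat ?n ?n" unfolding Hmat_def N_def[symmetric] using J by simp
  have M: "?M \<in> carrier_mat ?n ?n"
    using Mmat_eq_inverse_mult[OF \<beta>, of \<gamma>] Nmat_carrier by (metis mult_carrier_mat)
  have MT: "transpose_mat ?M \<in> carrier_mat ?n ?n" using M by simp
  have Md: "?M *\<^sub>v d \<in> carrier_vec ?n" using M d by (rule mult_mat_vec_carrier)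
  have HMd: "?H *\<^sub>v (?M *\<^sub>v d) \<in> carrier_vec ?n" using H Md by (rule mult_mat_vec_carrier)
  have Qd: "?Q *\<^sub>v d \<in> carrier_vec ?n" "transpose_mat ?Q *\<^sub>v d \<in> carrier_vec ?n"
    using Q QT d by (auto intro: mult_mat_vec_carrier)
  have Y: "transpose_mat ?M * ?H * ?M *\<^sub>v d = transpose_mat ?M *\<^sub>v (?H *\<^sub>v (?M *\<^sub>v d))"
    using M MT H d Md by (simp add: assoc_mult_mat_vec[of _ ?n ?n _ ?n])
  have Yc: "transpose_mat ?M *\<^sub>v (?H *\<^sub>v (?M *\<^sub>v d)) \<in> carrier_vec ?n"
    using MT HMd by (rule mult_mat_vec_carrier)
  have "Gmat m l \<gamma> \<beta> *\<^sub>v d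
      = (transpose_mat ?Q *\<^sub>v d + ?Q *\<^sub>v d) - transpose_mat ?M *\<^sub>v (?H *\<^sub>v (?M *\<^sub>v d))"
    unfolding Gmat_def Y[symmetric] using Q QT M MT H d
    by (subst minus_mult_distrib_mat_vec[of _ ?n ?n]) (auto simp: add_mult_distrib_mat_vec[of _ ?n ?n])
  then have "qform (Gmat m l \<gamma> \<beta>) d
      = d \<bullet> (transpose_mat ?Q *\<^sub>v d) + d \<bullet> (?Q *\<^sub>v d) - d \<bullet> (transpose_mat ?M *\<^sub>v (?H *\<^sub>v (?M *\<^sub>v d)))"
    unfolding qform_def using d Qd Yc
    by (simp add: scalar_prod_minus_distrib[of _ ?n] scalar_prod_add_distrib[of _ ?n])
  also have "d \<bullet> (transpose_mat ?Q *\<^sub>v d) = d \<bullet> (?Q *\<^sub>v d)"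
    using transpose_vec_mult_scalar[OF Q d d] comm_scalar_prod[OF Qd(2) d] by simp
  also have "d \<bullet> (transpose_mat ?M *\<^sub>v (?H *\<^sub>v (?M *\<^sub>v d))) = qform ?H (?M *\<^sub>v d)"
    unfolding qform_def
    using transpose_vec_mult_scalar[OF M d HMd] comm_scalar_prod[OF Yc d] comm_scalar_prod[OF HMd Md] by simp
  also have "qform ?H (?M *\<^sub>v d) = \<gamma> * (\<beta> * (a \<bullet> a) + (r \<bullet> r) / \<beta>)"
    unfolding d_def u(2) using u r a \<gamma>
    by (subst qform_Hmat) (auto simp: field_simps)
  also have "d \<bullet> (?Q *\<^sub>v d) = \<beta> * (a \<bullet> (Jmat m l *\<^sub>v a)) + (e \<bullet> e) / \<beta> - e \<bullet> s"
  proof -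
    have "?Q *\<^sub>v d = (\<beta> \<cdot>\<^sub>v (Jmat m l *\<^sub>v a)) @\<^sub>v (- s + (1 / \<beta>) \<cdot>\<^sub>v e)"
      unfolding d_def Qmat_def N_def[symmetric] s_def using J I a e Ja
      by (simp add: zero_mat_mult_vec[of _ l] zero_mat_mult_vec[of _ N] four_block_mat_mult_vec[of _ N N _ l _ l] smult_mat_mult_vec[of _ N N] smult_mat_mult_vec[of _ l l])
    also have "- s + (1 / \<beta>) \<cdot>\<^sub>v e = (1 / \<beta>) \<cdot>\<^sub>v e - s" using s e by (intro eq_vecI) auto
    finally show ?thesis unfolding d_def using a e s Ja
      by (simp add: scalar_prod_append[of _ N _ l] scalar_prod_minus_distrib[of _ l])
  qed
  finally have G: "qform (Gmat m l \<gamma> \<beta>) d = 2 * (\<beta> * (a \<bullet> (Jmat m l *\<^sub>v a)) + (e \<bullet> e) / \<beta> - e \<bullet> s)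
      - \<gamma> * (\<beta> * (a \<bullet> a) + (r \<bullet> r) / \<beta>)" by simp
  have rr: "r \<bullet> r = e \<bullet> e - 2 * \<beta> * (e \<bullet> s) + \<beta> * \<beta> * (s \<bullet> s)"
    unfolding r_def using e s comm_scalar_prod[OF e s]
    by (simp add: scalar_prod_minus_distrib[of _ l] minus_scalar_prod_distrib[of _ l] algebra_simps)
  have "2 * \<beta> * (a \<bullet> (Jmat m l *\<^sub>v a)) = \<beta> * (a \<bullet> a + s \<bullet> s)"
    using Jmat_quadratic[OF a] unfolding s_def by simp
  then have "qform (Gmat m l \<gamma> \<beta>) d = \<beta> * (a \<bullet> a + s \<bullet> s) + 2 * (e \<bullet> e) / \<beta> - 2 * (e \<bullet> s)
      - \<gamma> * (\<beta> * (a \<bullet> a) + (r \<bullet> r) / \<beta>)" unfolding G by (simp add: algebra_simps)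
  also have "\<dots> = (1 - \<gamma>) * (\<beta> * (a \<bullet> a) + (r \<bullet> r) / \<beta>) + (e \<bullet> e) / \<beta>"
    unfolding rr using \<beta> by (simp add: field_simps)
  finally show ?thesis unfolding d_def r_def s_def .
qed

text \<open>
  The position \<open>k\<close> in the stacked vector lies in the block \<open>k div l + 2\<close>; grouping the positions by
  blocks turns the product with \<open>(I \<dots> I)\<close> into the sum of the blocks.
\<close>

lemma Itilde_mult_blocks:
  assumes m: "2 \<le> m" and y: "\<And>j. j \<in> {2..m} \<Longrightarrow> y j \<in> carrier_vec l"
  shows "Itilde m l *\<^sub>v vec N (\<lambda>i. y (i div l + 2) $ (i mod l)) = finsum_vec TYPE(real) l y {2..m}"
    (is "?I *\<^sub>v ?v = ?s")
proof (rule eq_vecI)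
  have s: "?s \<in> carrier_vec l" using y by (intro finsum_vec_closed) auto
  show "dim_vec (?I *\<^sub>v ?v) = dim_vec ?s" using s Itilde_carrier by simp
  fix i assume "i < dim_vec ?s"
  then have i: "i < l" using s by simp
  let ?g = "\<lambda>k. if k mod l = i then y (k div l + 2) $ i else 0"
  have "(?I *\<^sub>v ?v) $ i = (\<Sum>k<N. ?I $$ (i, k) * y (k div l + 2) $ (k mod l))"
    using i Itilde_carrier by (simp add: scalar_prod_def lessThan_atLeast0)
  also have "\<dots> = (\<Sum>k<(m - 1) * l. ?g k)"
    using i by (intro sum.cong) (auto simp: Itilde_def N_def)
  also have "\<dots> = (\<Sum>p<m - 1. \<Sum>k\<in>{p * l..<p * l + l}. ?g k)"
    by (rule sum.nat_group[symmetric])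
  also have "\<dots> = (\<Sum>p<m - 1. y (p + 2) $ i)"
  proof (rule sum.cong[OF refl])
    fix p
    have "(\<Sum>k\<in>{p * l..<p * l + l}. ?g k) = (\<Sum>k\<in>{0..<l}. ?g (k + p * l))"
      using sum.shift_bounds_nat_ivl[of ?g 0 "p * l" l] by (simp add: add.commute)
    also have "\<dots> = (\<Sum>k\<in>{0..<l}. if k = i then y (p + 2) $ i else 0)"
      by (rule sum.cong) (auto simp: add.commute)
    also have "\<dots> = y (p + 2) $ i" using i by simp
    finally show "(\<Sum>k\<in>{p * l..<p * l + l}. ?g k) = y (p + 2) $ i" .
  qed
  also have "\<dots> = (\<Sum>j\<in>{2..m}. y j $ i)"
    using m by (intro sum.reindex_bij_witness[of _ "\<lambda>j. j - 2" "\<lambda>p. p + 2"]) auto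
  also have "\<dots> = ?s $ i"
    using y i by (subst index_finsum_vec) auto
  finally show "(?I *\<^sub>v ?v) $ i = ?s $ i" .
qed

end

section \<open>The convergence condition\<close>

lemma pos_semidef_H0mat:
  assumes Am: "Am \<in> carrier_mat l p" and "0 < L" "0 < \<gamma>" "\<gamma> \<le> 1" "0 < \<beta>"
  shows "pos_semidef ((m - 1) * l + l) (H0mat m l Am L \<gamma> \<beta>)"
proof -
  let ?N = "(m - 1) * l" and ?J = "Jmat m l"
  note J = Jmat_carrier[of m l]
  let ?c = "1 / \<beta>\<^sup>2 + (1 - \<gamma>) * (sigma_min (Am * transpose_mat Am) / (L * \<beta>))"
  have "transpose_mat (?J * transpose_mat ?J) = ?J * transpose_mat ?J"
    using J by (simp add: transpose_mult[of _ ?N ?N])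
  then have sym: "transpose_mat (H0mat m l Am L \<gamma> \<beta>) = H0mat m l Am L \<gamma> \<beta>"
    unfolding H0mat_def using J
    by (subst transpose_smult_mat, subst transpose_four_block_mat[of _ ?N ?N _ l _ l])
      (auto simp: transpose_smult_mat)
  have nonneg: "0 \<le> qform (H0mat m l Am L \<gamma> \<beta>) x" if x: "x \<in> carrier_vec (?N + l)" for x
  proof -
    define a e where "a = vec_first x ?N" and "e = vec_last x l"
    have a: "a \<in> carrier_vec ?N" and e: "e \<in> carrier_vec l" and xe: "x = a @\<^sub>v e"
      unfolding a_def e_def using x by auto
    have "0 \<le> ?c * (e \<bullet> e)"
    proof (cases "l = 0")
      case True
      then have "e \<bullet> e = 0" using e by (simp add: scalar_prod_eq_sum)
      then show ?thesis by simp
    next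
      case False
      then have "0 \<le> sigma_min (Am * transpose_mat Am)"
        using sigma_min_mult_transpose(2)[OF Am e] by simp
      then show ?thesis using assms scalar_prod_self_nonneg[of e] by simp
    qed
    then show ?thesis unfolding xe qform_H0mat[OF a e]
      using \<open>0 < \<gamma>\<close> add_nonneg_nonneg[OF scalar_prod_self_nonneg]
      by (intro mult_nonneg_nonneg) auto
  qed
  show ?thesis unfolding pos_semidef_def
  proof (intro conjI ballI sym nonneg)
    show "H0mat m l Am L \<gamma> \<beta> \<in> carrier_mat (?N + l) (?N + l)"
      unfolding H0mat_def using J by simp
  qed
qed

text \<open>
  The scalar core of the condition. Here \<open>X0, X'\<close> are the squared errors \<open>\<parallel>J\<^sup>T a\<parallel>\<^sup>2\<close> of the upper blocks
  before and after the step, \<open>E0, E'\<close> those of the multiplier, \<open>W\<close> is \<open>\<parallel>w - \<lambda>\<^sup>*\<parallel>\<^sup>2\<close>, \<open>Z\<close> the squared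
  gradient difference and \<open>G\<close> the form of \<open>G\<^sup>k\<close>. After multiplication by \<open>\<gamma>\<close> and with \<open>c'\<close> replaced by its bound both sides contain
  \<open>X' - X0 + (E' - E0) / \<beta>\<^sup>2\<close>; the remainder \<open>\<sigma> (E' - (1 - \<gamma>) E0) / (L \<beta>)\<close> on the left is at most
  \<open>\<gamma> \<sigma> W / (L \<beta>)\<close>, which the term with \<open>Z\<close> covers,
  and \<open>G\<close> only adds to the right-hand side.
\<close>

lemma descent_arithmetic:
  fixes X0 X' E0 E' W Z G :: real
  assumes "0 < \<beta>" "0 < \<gamma>" "0 < L" "0 \<le> G" "0 \<le> E'"
    and conv: "\<sigma> * E' \<le> \<sigma> * ((1 - \<gamma>) * E0 + \<gamma> * W)" and Z: "\<sigma> * W \<le> Z"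
    and c': "c' \<le> 1 / \<beta>\<^sup>2 + \<sigma> / (L * \<beta>)"
  shows "1 / \<gamma> * (X' + c' * E') - 1 / \<gamma> * (X0 + (1 / \<beta>\<^sup>2 + (1 - \<gamma>) * (\<sigma> / (L * \<beta>))) * E0)
    \<le> 1 / \<beta> * (1 / \<gamma> * (\<beta> * X' + 1 / \<beta> * E') + 1 / L * Z
        - 1 / \<gamma> * (\<beta> * X0 + 1 / \<beta> * E0) + G)"
proof -
  have "c' * E' \<le> (1 / \<beta>\<^sup>2 + \<sigma> / (L * \<beta>)) * E'" using c' assms by (intro mult_right_mono)
  also have "\<dots> = E' / \<beta>\<^sup>2 + (\<sigma> * E') / (L * \<beta>)" by (simp add: algebra_simps)
  also have "(\<sigma> * E') / (L * \<beta>) \<le> ((1 - \<gamma>) * \<sigma> * E0 + \<gamma> * Z) / (L * \<beta>)"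
  proof (rule divide_right_mono)
    have "\<gamma> * (\<sigma> * W) \<le> \<gamma> * Z" using Z assms by simp
    then show "\<sigma> * E' \<le> (1 - \<gamma>) * \<sigma> * E0 + \<gamma> * Z" using conv by (simp add: algebra_simps)
  qed (use assms in simp)
  finally have "c' * E' \<le> E' / \<beta>\<^sup>2 + ((1 - \<gamma>) * \<sigma> * E0 + \<gamma> * Z) / (L * \<beta>)" by simp
  then have "(X' + c' * E') - (X0 + (1 / \<beta>\<^sup>2 + (1 - \<gamma>) * (\<sigma> / (L * \<beta>))) * E0)
      \<le> (X' - X0) + (E' - E0) / \<beta>\<^sup>2 + \<gamma> * Z / (L * \<beta>)"
    by (simp add: algebra_simps add_divide_distrib diff_divide_distrib)
  then have "1 / \<gamma> * ((X' + c' * E') - (X0 + (1 / \<beta>\<^sup>2 + (1 - \<gamma>) * (\<sigma> / (L * \<beta>))) * E0))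
      \<le> 1 / \<gamma> * ((X' - X0) + (E' - E0) / \<beta>\<^sup>2 + \<gamma> * Z / (L * \<beta>))"
    using assms by (intro mult_left_mono) auto
  also have "\<dots> = 1 / \<beta> * (1 / \<gamma> * (\<beta> * X' + 1 / \<beta> * E') + 1 / L * Z
        - 1 / \<gamma> * (\<beta> * X0 + 1 / \<beta> * E0))"
    using assms by (simp add: field_simps power2_eq_square)
  also have "\<dots> \<le> 1 / \<beta> * (1 / \<gamma> * (\<beta> * X' + 1 / \<beta> * E') + 1 / L * Z
        - 1 / \<gamma> * (\<beta> * X0 + 1 / \<beta> * E0) + G)"
    using assms by (intro mult_left_mono) auto
  finally show ?thesis by (simp add: algebra_simps)
qed

theorem theorem3p5:
  fixes m l :: nat
    and n :: "nat \<Rightarrow> nat"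
    and f :: "nat \<Rightarrow> real vec \<Rightarrow> real"
    and A :: "nat \<Rightarrow> real mat"
    and b :: "real vec"
    and L \<gamma> :: real
    and \<beta> :: "nat \<Rightarrow> real"
    and xs :: "nat \<Rightarrow> real vec" and lams vs :: "real vec"
    and y xt :: "nat \<Rightarrow> nat \<Rightarrow> real vec"
    and lam lamt v vt :: "nat \<Rightarrow> real vec"
  assumes "2 \<le> m"
    and "\<And>i. i \<in> {1..m} \<Longrightarrow> closed_proper_convex (n i) (f i)"
    and "\<And>i. i \<in> {1..m} \<Longrightarrow> A i \<in> carrier_mat l (n i)"
    and "b \<in> carrier_vec l"
    and "0 < L"
    and "gradient_lipschitz (n m) L (f m)"
    and "is_saddle_point m l n f A b xs lams"
    and "vs = stack m l (\<lambda>j. A j *\<^sub>v xs j) lams"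
    and "0 < \<gamma>" and "\<gamma> \<le> 1"
    and "\<And>k. 0 < \<beta> k"
    and "\<And>k. 1 / (\<beta> k)\<^sup>2 + sigma_min (A m * transpose_mat (A m)) / (L * \<beta> k)
           \<ge> 1 / (\<beta> (Suc k))\<^sup>2
              + (1 - \<gamma>) * (sigma_min (A m * transpose_mat (A m)) / (L * \<beta> (Suc k)))"
    and "\<And>k j. j \<in> {2..m} \<Longrightarrow> y k j \<in> carrier_vec l"
    and "\<And>k. lam k \<in> carrier_vec l"
    and "\<And>k. v k = stack m l (y k) (lam k)"
    and "\<And>k. vt k = stack m l (\<lambda>j. A j *\<^sub>v xt k j) (lamt k)"
    and "\<And>k j. j \<in> {1..m} \<Longrightarrow>
           is_arg_min (prediction_obj m l f A b (\<beta> k) (xt k) (y k) (lam k) j)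
             (\<lambda>x. x \<in> carrier_vec (n j)) (xt k j)"
    and "\<And>k. lamt k = lam k - \<beta> k \<cdot>\<^sub>v
           (A 1 *\<^sub>v xt k 1 + finsum_vec TYPE(real) l (y k) {2..m} - b)"
    and "\<And>k. v (Suc k) = v k - Mmat m l \<gamma> (\<beta> k) *\<^sub>v (v k - vt k)"
  shows "CC3 ((m - 1) * l + l)
           (\<lambda>k. 1 / \<beta> k) (1 / L) (1\<^sub>m (n m))
           (\<lambda>k. Hmat m l \<gamma> (\<beta> k)) (\<lambda>k. Gmat m l \<gamma> (\<beta> k))
           (\<lambda>k. H0mat m l (A m) L \<gamma> (\<beta> k)) (\<lambda>k. 0)
           v vt (\<lambda>k. gradient (n m) (f m) (xt k m))
           vs (gradient (n m) (f m) (xs m))"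
proof -
  note m = assms(1) and A = assms(3) and b = assms(4) and L = assms(5) and glip = assms(6)
    and saddle = assms(7) and vs = assms(8) and \<gamma> = assms(9,10) and \<beta> = assms(11)
    and \<beta>_step = assms(12) and y = assms(13) and lam = assms(14) and v = assms(15)
    and vt = assms(16) and pred = assms(17) and lamt_eq = assms(18) and correction = assms(19)
  define N where "N = (m - 1) * l"
  define top where "top z = vec N (\<lambda>i. z (i div l + 2) $ (i mod l))" for z :: "nat \<Rightarrow> real vec"
  have top: "top z \<in> carrier_vec N" for z unfolding top_def by simp
  have stack: "stack m l z w = top z @\<^sub>v w" for z w unfolding stack_def top_def N_def ..
  have mm: "m \<in> {1..m}" using m by simp
  note Am = A[OF mm]
  define \<sigma> where "\<sigma> = sigma_min (A m * transpose_mat (A m))"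
  have xs: "xs i \<in> carrier_vec (n i)" if "i \<in> {1..m}" for i
    using saddle that unfolding is_saddle_point_def by auto
  have lams: "lams \<in> carrier_vec l" using saddle unfolding is_saddle_point_def by auto
  have xt: "xt k i \<in> carrier_vec (n i)" if "i \<in> {1..m}" for k i
    using pred[OF that] unfolding is_arg_min_def by auto
  have Axt: "A i *\<^sub>v xt k i \<in> carrier_vec l" if "i \<in> {1..m}" for k i
    using A[OF that] xt[OF that] by (rule mult_mat_vec_carrier)
  have grad: "has_gradient (n m) (f m) x (gradient (n m) (f m) x)" if x: "x \<in> carrier_vec (n m)" for x
  proof -
    obtain g where "has_gradient (n m) (f m) x g"
      using glip x unfolding gradient_lipschitz_def by blast
    then show ?thesis using gradient_eqI[OF _ x] by simp
  qed
  have gs: "gradient (n m) (f m) (xs m) = transpose_mat (A m) *\<^sub>v lams"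
    by (rule gradient_at_saddle_point[OF mm A b saddle grad[OF xs[OF mm]]])
  have main: "qform (H0mat m l (A m) L \<gamma> (\<beta> (Suc k))) (v (Suc k) - vs)
        - qform (H0mat m l (A m) L \<gamma> (\<beta> k)) (v k - vs)
      \<le> 1 / \<beta> k * (qform (Hmat m l \<gamma> (\<beta> k)) (v (Suc k) - vs)
        + 1 / L * qform (1\<^sub>m (n m)) (gradient (n m) (f m) (xt k m) - gradient (n m) (f m) (xs m))
        - qform (Hmat m l \<gamma> (\<beta> k)) (v k - vs) + qform (Gmat m l \<gamma> (\<beta> k)) (v k - vt k))" for k
  proof -
    define t s where "t = finsum_vec TYPE(real) l (\<lambda>j. A j *\<^sub>v xt k j) {2..m}"
      and "s = finsum_vec TYPE(real) l (y k) {2..m}"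
    have t: "t \<in> carrier_vec l" and s: "s \<in> carrier_vec l"
      unfolding t_def s_def using Axt y by (auto intro!: finsum_vec_closed)
    have A1: "A 1 *\<^sub>v xt k 1 \<in> carrier_vec l" using Axt m by auto
    have lamt_k: "lamt k = lam k - \<beta> k \<cdot>\<^sub>v (A 1 *\<^sub>v xt k 1 + s - b)"
      unfolding s_def by (rule lamt_eq)
    have lamt: "lamt k \<in> carrier_vec l" unfolding lamt_k using lam A1 s b by simp
    define a e where "a = top (y k) - top (\<lambda>j. A j *\<^sub>v xt k j)" and "e = lam k - lamt k"
    have a: "a \<in> carrier_vec N" and e: "e \<in> carrier_vec l"
      unfolding a_def e_def using top lam lamt by auto
    have d: "v k - vt k = a @\<^sub>v e"
      unfolding v vt stack a_def e_def using top top lam lamt by (rule append_vec_diff)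
    have Ia: "Itilde m l *\<^sub>v a = s - t"
      unfolding a_def s_def t_def
      using Itilde_mult_blocks[OF m, of "y k"] Itilde_mult_blocks[OF m, of "\<lambda>j. A j *\<^sub>v xt k j"]
        Itilde_carrier[of m l] top y Axt m
      unfolding top_def N_def by (subst mult_minus_distrib_mat_vec[of _ l "(m - 1) * l"]) auto
    \<comment> \<open>\<open>- \<gamma> r\<close> is the change of the multiplier; the \<open>y\<^sub>j\<close> in \<open>e\<close> and in \<open>a\<close> cancel, so that \<open>r\<close> is
    \<open>\<beta>\<close> times the residual of the predicted point, see \<open>r_eq\<close>\<close>
    define r where "r = e - \<beta> k \<cdot>\<^sub>v (Itilde m l *\<^sub>v a)"
    have r: "r \<in> carrier_vec l" unfolding r_def Ia using e s t by simp
    define w where "w = lam k - r"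
    have w: "w \<in> carrier_vec l" unfolding w_def using lam r by simp
    have r_eq: "r = \<beta> k \<cdot>\<^sub>v (A 1 *\<^sub>v xt k 1 + t - b)"
      unfolding r_def Ia e_def lamt_k using lam A1 s t b
      by (intro eq_vecI) (auto simp: algebra_simps simp del: index_mult_mat_vec)
    have gt: "gradient (n m) (f m) (xt k m) = transpose_mat (A m) *\<^sub>v w"
      unfolding w_def r_eq t_def
      by (rule gradient_at_last_prediction[OF m A b lam xt pred[OF mm] grad[OF xt[OF mm]]])
    obtain u where u: "u \<in> carrier_vec N"
      "Mmat m l \<gamma> (\<beta> k) *\<^sub>v (a @\<^sub>v e) = u @\<^sub>v (\<gamma> \<cdot>\<^sub>v r)"
      using Mmat_mult_vec[OF \<beta>[of k] a[unfolded N_def] e, of \<gamma>] unfolding r_def N_def by blast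
    have "top (y (Suc k)) @\<^sub>v lam (Suc k) = (top (y k) - u) @\<^sub>v (lam k - \<gamma> \<cdot>\<^sub>v r)"
      using correction[of k] unfolding d u(2) unfolding v stack
      using append_vec_diff[OF top u(1) lam, of "\<gamma> \<cdot>\<^sub>v r"] r by simp
    then have lam': "lam (Suc k) = lam k - \<gamma> \<cdot>\<^sub>v r"
      using append_vec_eq[OF top, of "top (y k) - u"] top u(1) by auto
    define a0 e0 a' e' where "a0 = top (y k) - top (\<lambda>j. A j *\<^sub>v xs j)" and "e0 = lam k - lams"
      and "a' = top (y (Suc k)) - top (\<lambda>j. A j *\<^sub>v xs j)" and "e' = lam (Suc k) - lams"
    have car: "a0 \<in> carrier_vec N" "e0 \<in> carrier_vec l" "a' \<in> carrier_vec N" "e' \<in> carrier_vec l"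
      unfolding a0_def e0_def a'_def e'_def using top lam lams by auto
    have d0: "v k - vs = a0 @\<^sub>v e0" and d': "v (Suc k) - vs = a' @\<^sub>v e'"
      unfolding v vs stack a0_def e0_def a'_def e'_def using top top lam lams by (auto intro: append_vec_diff)
    note car' = car[unfolded N_def]
    have e'_eq: "e' = (1 - \<gamma>) \<cdot>\<^sub>v e0 + \<gamma> \<cdot>\<^sub>v (w - lams)"
      unfolding e'_def e0_def lam' w_def using lam r lams
      by (intro eq_vecI) (auto simp: algebra_simps)
    have wl: "w - lams \<in> carrier_vec l" using w lams by simp
    have conv: "e' \<bullet> e' \<le> (1 - \<gamma>) * (e0 \<bullet> e0) + \<gamma> * ((w - lams) \<bullet> (w - lams))"
      unfolding e'_eq using car(2) wl \<gamma> by (intro convex_combination_scalar_prod_self) auto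
    \<comment> \<open>\<open>0 \<le> \<sigma>\<close> is available for \<open>l > 0\<close> only; for \<open>l = 0\<close> all the squared norms vanish\<close>
    have \<sigma>conv: "\<sigma> * (e' \<bullet> e') \<le> \<sigma> * ((1 - \<gamma>) * (e0 \<bullet> e0) + \<gamma> * ((w - lams) \<bullet> (w - lams)))"
    proof (cases "l = 0")
      case True
      then have "x \<bullet> x = 0" if "x \<in> carrier_vec l" for x :: "real vec"
        using that by (simp add: scalar_prod_eq_sum)
      then show ?thesis using car wl by simp
    next
      case False
      then have "0 \<le> \<sigma>" unfolding \<sigma>_def using sigma_min_mult_transpose(2)[OF Am w] by simp
      then show ?thesis using conv by (rule mult_left_mono[rotated])
    qed
    define z where "z = transpose_mat (A m) *\<^sub>v (w - lams)"
    have z: "z \<in> carrier_vec (n m)" unfolding z_def using Am wl by (auto intro: mult_mat_vec_carrier)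
    have dz: "gradient (n m) (f m) (xt k m) - gradient (n m) (f m) (xs m) = z"
      unfolding gt gs z_def using Am w lams by (subst mult_minus_distrib_mat_vec[of _ "n m" l]) auto
    have qz: "qform (1\<^sub>m (n m)) z = z \<bullet> z" unfolding qform_def using z by simp
    have \<sigma>z: "\<sigma> * ((w - lams) \<bullet> (w - lams)) \<le> z \<bullet> z"
      unfolding \<sigma>_def z_def by (rule sigma_min_mult_transpose(1)[OF Am wl])
    have G: "0 \<le> qform (Gmat m l \<gamma> (\<beta> k)) (a @\<^sub>v e)"
      unfolding qform_Gmat[OF \<beta> \<gamma>(1) a[unfolded N_def] e] using \<gamma> \<beta>[of k]
      by (intro add_nonneg_nonneg mult_nonneg_nonneg divide_nonneg_pos scalar_prod_self_nonneg) auto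
    show ?thesis
      unfolding d d0 d' dz qz qform_Hmat[OF car'(1,2)] qform_Hmat[OF car'(3,4)]
        qform_H0mat[OF car'(1,2)] qform_H0mat[OF car'(3,4)] \<sigma>_def[symmetric]
      using \<beta>_step[of k, folded \<sigma>_def]
      by (intro descent_arithmetic[OF \<beta> \<gamma>(1) L G scalar_prod_self_nonneg \<sigma>conv \<sigma>z])
  qed
  show ?thesis
    unfolding CC3_def
    using main \<beta> pos_semidef_H0mat[OF Am L \<gamma> \<beta>] by simp
qed

end
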